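(* There is a quantum query algorithm that, for every integer $n$ and every function $f:\{0,\dots,n-1\}\to\{0,1,2\}$, solves the problem $SZBT(f,n)$ (find any segment of $0$s bounded by $2$s, or report that there is none) with query complexity $O(\sqrt{n\log n}\cdot T_f)$ and error probability at most $0.1$, where $T_f$ is the query complexity of computing $f$. In particular, if $T_f=O(1)$, then the query complexity is $O(\sqrt{n\log n})$.
   Context: Problem $SZBT(f,n)$: given $f:\{0,\dots,n-1\}\to\{0,1,2\}$, a pair $(l,r)$ with $0\le l<r\le n-1$ is a segment of $0$s bounded by $2$s if $f(l)=f(r)=2$ and $f(i)=0$ for all $l<i<r$ (i.e. the string $f(0)f(1)\cdots f(n-1)$ contains a substring of the form $20^*2$ in positions $l,\dots,r$). The goal is to output any such pair, or $(NULL,NULL)$ if there is none. Quantum query model: the input is accessed through a query unitary $|i\rangle|z\rangle|w\rangle\mapsto|i\rangle|z+ x_i\rangle|w\rangle$ (addition modulo the alphabet size), where $x_i$ is the $i$-th input value. An algorithm alternates input-independent unitaries with applications of the query unitary and ends with a measurement; its query complexity is the number of applications of the query unitary. The error probability is the maximum over inputs of the probability that the output is not correct. $T_f$ denotes the query complexity of computing $f$: the number of queries used for one (coherent) evaluation $i\mapsto f(i)$; $T_f=1$ if $f$ itself is the queried input. *)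

theory Defs
  imports Complex_Main "HOL-Library.FuncSet" "HOL-Library.Landau_Symbols"
begin

(* Segments of 0s bounded by 2s *)

definition bounded_segment :: "nat \<Rightarrow> (nat \<Rightarrow> nat) \<Rightarrow> nat \<Rightarrow> nat \<Rightarrow> bool" where
  "bounded_segment n f l r \<longleftrightarrow>
     l < r \<and> r \<le> n - 1 \<and> f l = 2 \<and> f r = 2 \<and> (\<forall>i. l < i \<and> i < r \<longrightarrow> f i = 0)"

(* None stands for the answer (NULL, NULL). *)
definition szbt_correct :: "nat \<Rightarrow> (nat \<Rightarrow> nat) \<Rightarrow> (nat \<times> nat) option \<Rightarrow> bool" where
  "szbt_correct n f ans \<longleftrightarrow>
     (case ans of
        None \<Rightarrow> \<not> (\<exists>l r. bounded_segment n f l r)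
      | Some (l, r) \<Rightarrow> bounded_segment n f l r)"

(* Finite-dimensional quantum states over an orthonormal basis labelled by a finite set B.
   States and operators are total functions of which only the values on B matter.
   Labels are tuples rather than numbers, so that a composite system is simply a product of
   label sets.  An operator U has the matrix entry U b b' in row b (output), column b' (input). *)

type_synonym 'b qstate = "'b \<Rightarrow> complex"
type_synonym 'b qoperator = "'b \<Rightarrow> 'b \<Rightarrow> complex"

definition ket :: "'b \<Rightarrow> 'b qstate" where
  "ket b = (\<lambda>b'. if b' = b then 1 else 0)"

definition apply_op :: "'b set \<Rightarrow> 'b qoperator \<Rightarrow> 'b qstate \<Rightarrow> 'b qstate" where
  "apply_op B U \<psi> = (\<lambda>b. \<Sum>b'\<in>B. U b b' * \<psi> b')"

definition unitary_on :: "'b set \<Rightarrow> 'b qoperator \<Rightarrow> bool" where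
  "unitary_on B U \<longleftrightarrow>
     (\<forall>b\<in>B. \<forall>b'\<in>B. (\<Sum>c\<in>B. cnj (U c b) * U c b') = (if b = b' then 1 else 0)) \<and>
     (\<forall>b\<in>B. \<forall>b'\<in>B. (\<Sum>c\<in>B. U b c * cnj (U b' c)) = (if b = b' then 1 else 0))"

(* Inputs x are strings of length N over the alphabet {0, ..., q - 1}; the registers
   (i, z, w) are the query index, the query target and the workspace. *)

type_synonym 'w qlabel = "nat \<times> nat \<times> 'w"

definition query_inputs :: "nat \<Rightarrow> nat \<Rightarrow> (nat \<Rightarrow> nat) set" where
  "query_inputs N q = {..<N} \<rightarrow>\<^sub>E {..<q}"

definition query_basis :: "nat \<Rightarrow> nat \<Rightarrow> 'w set \<Rightarrow> 'w qlabel set" where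
  "query_basis N q W = {..<N} \<times> {..<q} \<times> W"

definition query_op :: "nat \<Rightarrow> (nat \<Rightarrow> nat) \<Rightarrow> 'w qlabel qoperator" where
  "query_op q x = (\<lambda>b (i, z, w). ket (i, (z + x i) mod q, w) b)"

(* A circuit is a list of steps, executed from left to right.  A gate is fixed in advance and
   so cannot depend on the input. *)
datatype 'w qstep = Gate "'w qlabel qoperator" | Query

definition query_count :: "'w qstep list \<Rightarrow> nat" where
  "query_count ss = count_list ss Query"

definition valid_circuit :: "nat \<Rightarrow> nat \<Rightarrow> 'w set \<Rightarrow> 'w qstep list \<Rightarrow> bool" where
  "valid_circuit N q W ss \<longleftrightarrow>
     0 < N \<and> 0 < q \<and> finite W \<and> (\<forall>U. Gate U \<in> set ss \<longrightarrow> unitary_on (query_basis N q W) U)"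

primrec step_op :: "nat \<Rightarrow> (nat \<Rightarrow> nat) \<Rightarrow> 'w qstep \<Rightarrow> 'w qlabel qoperator" where
  "step_op q x (Gate U) = U"
| "step_op q x Query = query_op q x"

definition run_circuit ::
  "nat \<Rightarrow> nat \<Rightarrow> 'w set \<Rightarrow> (nat \<Rightarrow> nat) \<Rightarrow> 'w qstep list \<Rightarrow> 'w qlabel qstate \<Rightarrow> 'w qlabel qstate"
where
  "run_circuit N q W x ss = fold (\<lambda>s. apply_op (query_basis N q W) (step_op q x s)) ss"

(* The algorithm starts in the basis state (0, 0, qa_start), and its output is a function of
   the outcome of a measurement of all registers in the label basis. *)
record ('w, 'o) qalgorithm =
  qa_work :: "'w set"
  qa_start :: 'w
  qa_steps :: "'w qstep list"
  qa_output :: "'w qlabel \<Rightarrow> 'o"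

definition query_algorithm :: "nat \<Rightarrow> nat \<Rightarrow> ('w, 'o) qalgorithm \<Rightarrow> bool" where
  "query_algorithm N q A \<longleftrightarrow> valid_circuit N q (qa_work A) (qa_steps A) \<and> qa_start A \<in> qa_work A"

definition final_state ::
  "nat \<Rightarrow> nat \<Rightarrow> ('w, 'o) qalgorithm \<Rightarrow> (nat \<Rightarrow> nat) \<Rightarrow> 'w qlabel qstate" where
  "final_state N q A x = run_circuit N q (qa_work A) x (qa_steps A) (ket (0, 0, qa_start A))"

definition output_prob ::
  "nat \<Rightarrow> nat \<Rightarrow> ('w, 'o) qalgorithm \<Rightarrow> (nat \<Rightarrow> nat) \<Rightarrow> ('o \<Rightarrow> bool) \<Rightarrow> real" where
  "output_prob N q A x P =
     (\<Sum>b \<in> {b \<in> query_basis N q (qa_work A). P (qa_output A b)}. (cmod (final_state N q A x b))\<^sup>2)"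

(* X is the finite nonempty set of admissible inputs; correct x ans says that ans is a correct
   answer on input x. *)
definition error_prob ::
  "nat \<Rightarrow> nat \<Rightarrow> (nat \<Rightarrow> nat) set \<Rightarrow> ((nat \<Rightarrow> nat) \<Rightarrow> 'o \<Rightarrow> bool) \<Rightarrow> ('w, 'o) qalgorithm \<Rightarrow> real" where
  "error_prob N q X correct A = (MAX x\<in>X. output_prob N q A x (\<lambda>ans. \<not> correct x ans))"

(* For each input x, f x is a function from {0, ..., n - 1} to {0, 1, 2}.  The circuit E
   evaluates it coherently from queries to x: with an ancilla v in V initialised to v0 and with
   E's own query registers initialised to 0, it maps (i, z) to (i, z + f x i mod 3) and restores
   everything else.  The cost of one evaluation is query_count E. *)
definition coherent_evaluation ::
  "nat \<Rightarrow> nat \<Rightarrow> (nat \<Rightarrow> nat) set \<Rightarrow> nat \<Rightarrow> ((nat \<Rightarrow> nat) \<Rightarrow> nat \<Rightarrow> nat) \<Rightarrow>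
   'v set \<Rightarrow> 'v \<Rightarrow> (nat \<times> nat \<times> 'v) qstep list \<Rightarrow> bool"
where
  "coherent_evaluation N q X n f V v0 E \<longleftrightarrow>
     X \<noteq> {} \<and> X \<subseteq> query_inputs N q \<and>
     (\<forall>x\<in>X. \<forall>i<n. f x i \<in> {0, 1, 2}) \<and>
     v0 \<in> V \<and> finite V \<and> valid_circuit N q ({..<n} \<times> {..<3} \<times> V) E \<and>
     (\<forall>x\<in>X. \<forall>i<n. \<forall>z<3. \<forall>b \<in> query_basis N q ({..<n} \<times> {..<3} \<times> V).
        run_circuit N q ({..<n} \<times> {..<3} \<times> V) x E (ket (0, 0, (i, z, v0))) b =
        ket (0, 0, (i, (z + f x i) mod 3, v0)) b)"

(* Replacing every query of an algorithm A with oracle {0, ..., n - 1} -> {0, 1, 2} by an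
   evaluation circuit E.  The label (j, y, ((i, z, v), w)) of the resulting algorithm consists
   of the label (i, z, w) of A and the label (j, y, (i, z, v)) of E, which share (i, z). *)

fun lift_outer :: "'w qlabel qoperator \<Rightarrow> ((nat \<times> nat \<times> 'v) \<times> 'w) qlabel qoperator" where
  "lift_outer U (j, y, ((i, z, v), w)) (j', y', ((i', z', v'), w')) =
     (if j = j' \<and> y = y' \<and> v = v' then U (i, z, w) (i', z', w') else 0)"

fun lift_inner :: "'e qlabel qoperator \<Rightarrow> ('e \<times> 'w) qlabel qoperator" where
  "lift_inner U (j, y, (e, w)) (j', y', (e', w')) =
     (if w = w' then U (j, y, e) (j', y', e') else 0)"

primrec lift_inner_step :: "'e qstep \<Rightarrow> ('e \<times> 'w) qstep" where
  "lift_inner_step (Gate U) = Gate (lift_inner U)"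
| "lift_inner_step Query = Query"

primrec substitute_step ::
  "(nat \<times> nat \<times> 'v) qstep list \<Rightarrow> 'w qstep \<Rightarrow> ((nat \<times> nat \<times> 'v) \<times> 'w) qstep list" where
  "substitute_step E (Gate U) = [Gate (lift_outer U)]"
| "substitute_step E Query = map lift_inner_step E"

definition with_evaluation ::
  "nat \<Rightarrow> ('w, 'o) qalgorithm \<Rightarrow> 'v set \<Rightarrow> 'v \<Rightarrow> (nat \<times> nat \<times> 'v) qstep list \<Rightarrow>
   ((nat \<times> nat \<times> 'v) \<times> 'w, 'o) qalgorithm"
where
  "with_evaluation n A V v0 E =
     \<lparr> qa_work = ({..<n} \<times> {..<3} \<times> V) \<times> qa_work A,
       qa_start = ((0, 0, v0), qa_start A),
       qa_steps = concat (map (substitute_step E) (qa_steps A)),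
       qa_output = (\<lambda>(j, y, ((i, z, v), w)). qa_output A (i, z, w)) \<rparr>"

end

theory Submission
  imports Defs "HOL-Library.Countable"
begin

text \<open>
  Consider an electrical network in which every \<open>l\<close> has its own line of vertices: an edge available
  if \<open>f l = 2\<close>, then edges available if \<open>f i = 0\<close>, and from each vertex of the line an edge to the target
  available if \<open>f i = 2\<close>.  The available paths from source to target are exactly the bounded segments.
  Let \<open>U\<close> be the product of the reflections about the circulations and about the available edges,
  and let the walk start in an always available edge from target to source.  Solving the circuit
  splits this start vector into the electrical flow \<open>g\<close>, which \<open>U\<close> fixes and which is supported on
  segments, plus \<open>(w - U w) / 2\<close>, where \<open>w\<close> is the gradient of the potential.  So the average of
  \<open>U ^ j\<close> over \<open>j < T\<close> turns the start vector into \<open>g\<close> up to an error \<open>norm w / T\<close>, and measuring a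
  last edge of a flow path reveals a segment.

  A line edge at distance \<open>k\<close> from \<open>l\<close> gets conductance \<open>k * H\<close> with \<open>H\<close> the harmonic number, about
  \<open>ln n\<close>.  Then all paths have bounded resistance while the squared norm of \<open>w\<close> is
  \<open>O (n * H / c)\<close>, where \<open>c\<close> is the conductance of the starting edge.  The success probability is
  bounded below if \<open>c\<close> matches the total conductance of the segments, so all \<open>c = 2 ^ k \<le> n\<close> are tried
  a constant number of times.
\<close>

subsection \<open>Operators on finite bases\<close>

text \<open>Averaging replaces phase estimation. A counter \<open>j < T\<close> in uniform
  superposition controls \<open>j\<close> rounds of the walk; returning it to 0 leaves the average
  as a subnormalized branch, and a nonzero counter answers \<open>None\<close>. The flow vanishes on
  last edges that close no segment, so wrong pairs come from the averaging error alone and no pair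
  has to be verified.

  One solution of the circuit covers both kinds of input: without a segment the total conductance
  and the flow are 0, and the start vector is all of the form \<open>(w - U w) / 2\<close>. This
  shapes the conductances: small uniform ones give long runs a large resistance, large uniform ones
  make even short dead ends expensive.

  A larger \<open>c\<close> shortens the walk, but with total conductance \<open>t\<close> the flow
  captures only a share of order \<open>c * t / (c + t)^2\<close>, so \<open>c\<close> has to match
  an unknown quantity. All runs of all scales are joined into one measurement-free circuit in which
  wrong answers add up and failures multiply; hence the two error probabilities are kept
  apart.\<close>

lemma apply_op_cong:
  assumes "\<And>b. b \<in> B \<Longrightarrow> \<psi> b = \<phi> b"
  shows "apply_op B U \<psi> = apply_op B U \<phi>"
  unfolding apply_op_def using assms by (intro ext sum.cong) auto

lemma apply_op_sum:
  "apply_op B U (\<lambda>b. \<Sum>k\<in>K. a k * \<psi> k b) = (\<lambda>b. \<Sum>k\<in>K. a k * apply_op B U (\<psi> k) b)"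
  unfolding apply_op_def sum_distrib_left
  by (rule ext, subst sum.swap) (simp add: algebra_simps)

text \<open>Reflections, sign changes and \<open>spread\<close> are Hermitian and self-inverse, so
  both orthogonality conditions reduce to one.\<close>

lemma unitary_onI_involution:
  assumes "finite B"
    and herm: "\<And>b b'. b \<in> B \<Longrightarrow> b' \<in> B \<Longrightarrow> cnj (U b b') = U b' b"
    and inv: "\<And>b b'. b \<in> B \<Longrightarrow> b' \<in> B \<Longrightarrow> (\<Sum>c\<in>B. U b c * U c b') = (if b = b' then 1 else 0)"
  shows "unitary_on B U"
  unfolding unitary_on_def
proof (intro conjI ballI)
  fix b b' assume b: "b \<in> B" "b' \<in> B"
  have "(\<Sum>c\<in>B. cnj (U c b) * U c b') = (\<Sum>c\<in>B. U b c * U c b')"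
    using b herm by (intro sum.cong) auto
  then show "(\<Sum>c\<in>B. cnj (U c b) * U c b') = (if b = b' then 1 else 0)"
    using inv b by simp
  have "(\<Sum>c\<in>B. U b c * cnj (U b' c)) = (\<Sum>c\<in>B. U b c * U c b')"
    using b herm by (intro sum.cong) auto
  then show "(\<Sum>c\<in>B. U b c * cnj (U b' c)) = (if b = b' then 1 else 0)"
    using inv b by simp
qed

lemma unitary_on_permutation:
  assumes fin: "finite B" and bij: "bij_betw \<sigma> B B"
    and U: "\<And>b b'. b \<in> B \<Longrightarrow> b' \<in> B \<Longrightarrow> U b b' = (if b = \<sigma> b' then 1 else 0)"
  shows "unitary_on B U"
  unfolding unitary_on_def
proof (intro conjI ballI)
  fix b b' assume b: "b \<in> B" "b' \<in> B"
  have \<sigma>: "\<sigma> b \<in> B" "\<sigma> b' \<in> B" "\<sigma> b = \<sigma> b' \<longleftrightarrow> b = b'"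
    using b bij by (auto simp: bij_betw_def inj_on_def)
  have "(\<Sum>c\<in>B. cnj (U c b) * U c b') = (\<Sum>c\<in>B. if c = \<sigma> b then (if \<sigma> b = \<sigma> b' then 1 else 0) else 0)"
    using b U by (intro sum.cong) auto
  also have "\<dots> = (if b = b' then 1 else 0)"
    using fin \<sigma> by (simp add: sum.delta)
  finally show "(\<Sum>c\<in>B. cnj (U c b) * U c b') = (if b = b' then 1 else 0)" .
  obtain a where a: "a \<in> B" "\<sigma> a = b" using bij b by (metis bij_betw_def imageE)
  have inj: "\<And>c. c \<in> B \<Longrightarrow> b = \<sigma> c \<longleftrightarrow> c = a"
    using a bij by (auto simp: bij_betw_def inj_on_def)
  have "(\<Sum>c\<in>B. U b c * cnj (U b' c)) = (\<Sum>c\<in>B. if c = a then (if b' = b then 1 else 0) else 0)"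
    using b U inj a by (intro sum.cong) auto
  also have "\<dots> = (if b = b' then 1 else 0)"
    using fin a by (simp add: sum.delta)
  finally show "(\<Sum>c\<in>B. U b c * cnj (U b' c)) = (if b = b' then 1 else 0)" .
qed

lemma unitary_on_norm:
  assumes "unitary_on B U" "finite B"
  shows "(\<Sum>b\<in>B. (cmod (apply_op B U \<psi> b))\<^sup>2) = (\<Sum>b\<in>B. (cmod (\<psi> b))\<^sup>2)"
proof -
  have "complex_of_real (\<Sum>b\<in>B. (cmod (apply_op B U \<psi> b))\<^sup>2)
      = (\<Sum>b\<in>B. \<Sum>c\<in>B. \<Sum>c'\<in>B. (\<psi> c * cnj (\<psi> c')) * (cnj (U b c') * U b c))"
    by (simp add: complex_norm_square apply_op_def sum_product algebra_simps del: of_real_power)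
  also have "\<dots> = (\<Sum>c\<in>B. \<Sum>b\<in>B. \<Sum>c'\<in>B. (\<psi> c * cnj (\<psi> c')) * (cnj (U b c') * U b c))"
    by (rule sum.swap)
  also have "\<dots> = (\<Sum>c\<in>B. \<Sum>c'\<in>B. \<Sum>b\<in>B. (\<psi> c * cnj (\<psi> c')) * (cnj (U b c') * U b c))"
    by (rule sum.cong[OF refl], rule sum.swap)
  also have "\<dots> = (\<Sum>c\<in>B. \<Sum>c'\<in>B. (\<psi> c * cnj (\<psi> c')) * (if c' = c then 1 else 0))"
    using assms(1) unfolding unitary_on_def sum_distrib_left[symmetric]
    by (intro sum.cong refl) auto
  also have "\<dots> = (\<Sum>c\<in>B. \<psi> c * cnj (\<psi> c))"
    using assms(2) by (intro sum.cong refl) (simp add: if_distrib sum.delta cong: if_cong)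
  also have "\<dots> = complex_of_real (\<Sum>b\<in>B. (cmod (\<psi> b))\<^sup>2)"
    by (simp add: complex_norm_square del: of_real_power)
  finally show ?thesis by (simp only: of_real_eq_iff)
qed

text \<open>\<open>B\<close> is the register that \<open>block_op\<close> acts on, and \<open>S\<close> a spectator that may control the action.\<close>

locale factorization =
  fixes C :: "'c set" and B :: "'b set" and S :: "'s set"
    and dec :: "'c \<Rightarrow> 'b \<times> 's" and enc :: "'b \<times> 's \<Rightarrow> 'c"
  assumes finite_B: "finite B" and finite_S: "finite S"
    and dec_in: "c \<in> C \<Longrightarrow> dec c \<in> B \<times> S"
    and enc_in: "p \<in> B \<times> S \<Longrightarrow> enc p \<in> C"
    and enc_dec: "c \<in> C \<Longrightarrow> enc (dec c) = c"
    and dec_enc: "p \<in> B \<times> S \<Longrightarrow> dec (enc p) = p"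

definition block_op :: "('c \<Rightarrow> 'b \<times> 's) \<Rightarrow> ('s \<Rightarrow> 'b qoperator) \<Rightarrow> 'c qoperator" where
  "block_op dec U c c' =
     (if snd (dec c) = snd (dec c') then U (snd (dec c)) (fst (dec c)) (fst (dec c')) else 0)"

context factorization
begin

lemma bij_enc: "bij_betw enc (B \<times> S) C"
  by (rule bij_betw_byWitness[where f' = dec]) (use dec_enc enc_dec dec_in enc_in in blast)+

lemma finite_C: "finite C"
  using bij_enc finite_B finite_S bij_betw_finite by blast

lemma sum_factorization: "(\<Sum>c\<in>C. F c) = (\<Sum>b\<in>B. \<Sum>s\<in>S. F (enc (b, s)))"
  by (subst sum.reindex_bij_betw[OF bij_enc, symmetric]) (simp add: sum.cartesian_product case_prod_beta)

lemma sum_block: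
  assumes "s \<in> S"
  shows "(\<Sum>c\<in>C. if s = snd (dec c) then F c else 0) = (\<Sum>b\<in>B. F (enc (b, s)))"
  unfolding sum_factorization using assms finite_S
  by (intro sum.cong refl) (simp add: dec_enc sum.delta' cong: if_cong)

lemma apply_block_op:
  assumes "b \<in> B" "s \<in> S"
  shows "apply_op C (block_op dec U) \<psi> (enc (b, s)) = apply_op B (U s) (\<lambda>b'. \<psi> (enc (b', s))) b"
proof -
  have "apply_op C (block_op dec U) \<psi> (enc (b, s)) =
      (\<Sum>c\<in>C. if s = snd (dec c) then U s b (fst (dec c)) * \<psi> c else 0)"
    unfolding apply_op_def block_op_def using assms
    by (intro sum.cong refl) (auto simp: dec_enc)
  also have "\<dots> = (\<Sum>b'\<in>B. U s b b' * \<psi> (enc (b', s)))"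
    using assms by (subst sum_block) (auto simp: dec_enc)
  finally show ?thesis by (simp add: apply_op_def)
qed

lemma unitary_block_op:
  assumes U: "\<And>s. s \<in> S \<Longrightarrow> unitary_on B (U s)"
  shows "unitary_on C (block_op dec U)"
  unfolding unitary_on_def
proof (intro conjI ballI)
  fix c c' assume c: "c \<in> C" "c' \<in> C"
  obtain b s where bs: "dec c = (b, s)" "b \<in> B" "s \<in> S" using dec_in[OF c(1)] by auto
  obtain b' s' where bs': "dec c' = (b', s')" "b' \<in> B" "s' \<in> S" using dec_in[OF c(2)] by auto
  have eq: "c = c' \<longleftrightarrow> b = b' \<and> s = s'"
    using enc_dec[OF c(1)] enc_dec[OF c(2)] bs bs' by (metis prod.inject)
  have "(\<Sum>a\<in>C. cnj (block_op dec U a c) * block_op dec U a c') =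
      (\<Sum>a\<in>C. if s = snd (dec a) then
        (if s = s' then cnj (U s (fst (dec a)) b) * U s (fst (dec a)) b' else 0) else 0)"
    using bs bs' by (intro sum.cong refl) (auto simp: block_op_def)
  also have "\<dots> = (\<Sum>a\<in>B. if s = s' then cnj (U s a b) * U s a b' else 0)"
    using bs(3) by (subst sum_block) (auto simp: dec_enc intro!: sum.cong)
  also have "\<dots> = (if c = c' then 1 else 0)"
    using U[OF bs(3)] bs bs' eq by (cases "s = s'") (auto simp: unitary_on_def)
  finally show "(\<Sum>a\<in>C. cnj (block_op dec U a c) * block_op dec U a c') = (if c = c' then 1 else 0)" .
  have "(\<Sum>a\<in>C. block_op dec U c a * cnj (block_op dec U c' a)) =
      (\<Sum>a\<in>C. if s = snd (dec a) then
        (if s = s' then U s b (fst (dec a)) * cnj (U s b' (fst (dec a))) else 0) else 0)"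
    using bs bs' by (intro sum.cong refl) (auto simp: block_op_def)
  also have "\<dots> = (\<Sum>a\<in>B. if s = s' then U s b a * cnj (U s b' a) else 0)"
    using bs(3) by (subst sum_block) (auto simp: dec_enc intro!: sum.cong)
  also have "\<dots> = (if c = c' then 1 else 0)"
    using U[OF bs(3)] bs bs' eq by (cases "s = s'") (auto simp: unitary_on_def)
  finally show "(\<Sum>a\<in>C. block_op dec U c a * cnj (block_op dec U c' a)) = (if c = c' then 1 else 0)" .
qed

end

subsection \<open>Circuits\<close>

lemma finite_query_basis: "finite W \<Longrightarrow> finite (query_basis N q W)"
  by (simp add: query_basis_def)

lemma run_circuit_Nil [simp]: "run_circuit N q W x [] \<psi> = \<psi>"
  by (simp add: run_circuit_def)

lemma run_circuit_Cons [simp]: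
  "run_circuit N q W x (s # ss) \<psi> =
     run_circuit N q W x ss (apply_op (query_basis N q W) (step_op q x s) \<psi>)"
  by (simp add: run_circuit_def)

lemma run_circuit_append [simp]:
  "run_circuit N q W x (ss @ ts) \<psi> = run_circuit N q W x ts (run_circuit N q W x ss \<psi>)"
  by (simp add: run_circuit_def)

lemma run_circuit_cong:
  assumes "\<And>b. b \<in> query_basis N q W \<Longrightarrow> \<psi> b = \<phi> b" "b \<in> query_basis N q W"
  shows "run_circuit N q W x ss \<psi> b = run_circuit N q W x ss \<phi> b"
proof (cases ss)
  case (Cons s ts)
  then show ?thesis using apply_op_cong[OF assms(1), of "query_basis N q W"] by simp
qed (use assms in simp)

lemma run_circuit_sum:
  "run_circuit N q W x ss (\<lambda>b. \<Sum>k\<in>K. a k * \<psi> k b) =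
     (\<lambda>b. \<Sum>k\<in>K. a k * run_circuit N q W x ss (\<psi> k) b)"
  by (induction ss arbitrary: \<psi>) (simp_all add: apply_op_sum)

lemma run_circuit_scale:
  "run_circuit N q W x ss (\<lambda>b. a * \<psi> b) = (\<lambda>b. a * run_circuit N q W x ss \<psi> b)"
  using run_circuit_sum[of N q W x ss "\<lambda>_. a" "\<lambda>_. \<psi>" "{()}"] by simp

text \<open>\<open>q - a mod q\<close> plays the negative of \<open>a\<close> modulo
  \<open>q\<close>, since subtraction of naturals truncates.\<close>

lemma eq_add_mod_iff:
  fixes z z' a q :: nat
  assumes "z < q" "z' < q"
  shows "z = (z' + a) mod q \<longleftrightarrow> z' = (z + (q - a mod q)) mod q"
proof -
  have le: "a mod q \<le> q" using assms by (simp add: less_imp_le)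
  show ?thesis
  proof
    assume "z = (z' + a) mod q"
    then have "(z + (q - a mod q)) mod q = (z' + a mod q + (q - a mod q)) mod q"
      by (metis mod_add_left_eq mod_add_right_eq)
    also have "z' + a mod q + (q - a mod q) = z' + q" using le by linarith
    finally show "z' = (z + (q - a mod q)) mod q" using assms by simp
  next
    assume "z' = (z + (q - a mod q)) mod q"
    then have "(z' + a) mod q = (z + (q - a mod q) + a mod q) mod q"
      by (metis mod_add_left_eq mod_add_right_eq)
    also have "z + (q - a mod q) + a mod q = z + q" using le by linarith
    finally show "z = (z' + a) mod q" using assms by simp
  qed
qed

lemma query_op_delta:
  assumes "z < q" "z' < q"
  shows "query_op q x (i, z, w) (i', z', w') =
    (if (i', z', w') = (i, (z + (q - x i mod q)) mod q, w) then 1 else 0)"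
  using eq_add_mod_iff[OF assms, of "x i"] by (auto simp: query_op_def ket_def)

text \<open>On amplitudes a permutation of labels acts through its inverse, hence the subtraction of
  \<open>x i\<close>.\<close>

lemma apply_query_op:
  assumes "finite W" "i < N" "z < q" "w \<in> W"
  shows "apply_op (query_basis N q W) (query_op q x) \<psi> (i, z, w) =
    \<psi> (i, (z + (q - x i mod q)) mod q, w)"
proof -
  let ?b = "(i, (z + (q - x i mod q)) mod q, w)"
  have "apply_op (query_basis N q W) (query_op q x) \<psi> (i, z, w) =
      (\<Sum>b'\<in>query_basis N q W. if b' = ?b then \<psi> ?b else 0)"
    unfolding apply_op_def using assms
    by (intro sum.cong refl) (clarsimp simp: query_basis_def query_op_delta simp del: Nat.add_diff_assoc diff_is_0_eq split: if_splits)
  also have "\<dots> = \<psi> ?b"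
    using assms by (subst sum.delta) (auto simp: query_basis_def)
  finally show ?thesis .
qed

lemma unitary_query_op:
  assumes "finite W" "0 < q"
  shows "unitary_on (query_basis N q W) (query_op q x)"
proof (rule unitary_on_permutation)
  show "finite (query_basis N q W)" using assms(1) by (rule finite_query_basis)
  let ?\<sigma> = "\<lambda>(i, z, w). (i, (z + x i) mod q, w)"
  have "inj_on ?\<sigma> (query_basis N q W)"
  proof (rule inj_onI, clarsimp simp: query_basis_def)
    fix i z z' assume *: "z < q" "z' < q" "(z + x i) mod q = (z' + x i) mod q"
    then show "z = z'"
      using eq_add_mod_iff[of "(z + x i) mod q" q z "x i"] eq_add_mod_iff[of "(z + x i) mod q" q z' "x i"]
      by (metis mod_less_divisor gr_implies_not0 neq0_conv)
  qed
  moreover have "?\<sigma> ` query_basis N q W \<subseteq> query_basis N q W"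
    using assms by (auto simp: query_basis_def)
  ultimately show "bij_betw ?\<sigma> (query_basis N q W) (query_basis N q W)"
    using endo_inj_surj[OF finite_query_basis[OF assms(1)]] by (auto simp: bij_betw_def)
  show "\<And>b b'. b \<in> query_basis N q W \<Longrightarrow> b' \<in> query_basis N q W \<Longrightarrow>
      query_op q x b b' = (if b = ?\<sigma> b' then 1 else 0)"
    by (clarsimp simp: query_op_def ket_def split: if_splits)
qed

lemma run_circuit_norm:
  assumes "valid_circuit N q W ss"
  shows "(\<Sum>b\<in>query_basis N q W. (cmod (run_circuit N q W x ss \<psi> b))\<^sup>2) =
    (\<Sum>b\<in>query_basis N q W. (cmod (\<psi> b))\<^sup>2)"
  using assms
proof (induction ss arbitrary: \<psi>)
  case (Cons s ss)
  have "unitary_on (query_basis N q W) (step_op q x s)"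
    using Cons.prems by (cases s) (auto simp: valid_circuit_def unitary_query_op)
  moreover have "valid_circuit N q W ss" "finite W"
    using Cons.prems by (auto simp: valid_circuit_def)
  ultimately show ?case
    by (simp add: Cons.IH unitary_on_norm finite_query_basis)
qed simp

definition lift_dec :: "('u \<Rightarrow> 'w \<times> 's) \<Rightarrow> 'u qlabel \<Rightarrow> 'w qlabel \<times> 's" where
  "lift_dec dec = (\<lambda>(i, z, u). ((i, z, fst (dec u)), snd (dec u)))"

definition lift_enc :: "('w \<times> 's \<Rightarrow> 'u) \<Rightarrow> 'w qlabel \<times> 's \<Rightarrow> 'u qlabel" where
  "lift_enc enc = (\<lambda>((i, z, w), s). (i, z, enc (w, s)))"

primrec lift_step :: "('u \<Rightarrow> 'w \<times> 's) \<Rightarrow> 'w qstep \<Rightarrow> 'u qstep" where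
  "lift_step dec (Gate U) = Gate (block_op (lift_dec dec) (\<lambda>_. U))"
| "lift_step dec Query = Query"

lemma query_count_lift_step [simp]: "query_count (map (lift_step dec) ss) = query_count ss"
  unfolding query_count_def
proof (induction ss)
  case (Cons s ss)
  then show ?case by (cases s) auto
qed simp

context factorization
begin

lemma factorization_lift:
  "factorization (query_basis N q C) (query_basis N q B) S (lift_dec dec) (lift_enc enc)"
proof
  show "finite (query_basis N q B)" by (simp add: finite_query_basis finite_B)
  show "finite S" by (rule finite_S)
  show "c \<in> query_basis N q C \<Longrightarrow> lift_dec dec c \<in> query_basis N q B \<times> S" for c
    using dec_in[of "snd (snd c)"] by (cases c) (auto simp: query_basis_def lift_dec_def mem_Times_iff)
  show "p \<in> query_basis N q B \<times> S \<Longrightarrow> lift_enc enc p \<in> query_basis N q C" for p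
    using enc_in by (auto simp: query_basis_def lift_enc_def)
  show "c \<in> query_basis N q C \<Longrightarrow> lift_enc enc (lift_dec dec c) = c" for c
    using enc_dec by (auto simp: query_basis_def lift_dec_def lift_enc_def)
  show "p \<in> query_basis N q B \<times> S \<Longrightarrow> lift_dec dec (lift_enc enc p) = p" for p
    using dec_enc by (auto simp: query_basis_def lift_dec_def lift_enc_def)
qed

lemma valid_circuit_lift:
  assumes "valid_circuit N q B ss"
  shows "valid_circuit N q C (map (lift_step dec) ss)"
proof -
  interpret L: factorization "query_basis N q C" "query_basis N q B" S "lift_dec dec" "lift_enc enc"
    by (rule factorization_lift)
  have "unitary_on (query_basis N q C) U" if U: "Gate U \<in> set (map (lift_step dec) ss)" for U
  proof -
    obtain s where s: "s \<in> set ss" "Gate U = lift_step dec s" using U by auto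
    obtain U' where "s = Gate U'" "U = block_op (lift_dec dec) (\<lambda>_. U')"
      using s(2) by (cases s) auto
    then show ?thesis
      using assms s by (auto simp: valid_circuit_def intro!: L.unitary_block_op)
  qed
  then show ?thesis using assms finite_C by (auto simp: valid_circuit_def)
qed

text \<open>Neither the lifted gates nor the queries touch the spectator, so each fixed
  \<open>s\<close> runs the original circuit on its own slice of the state.\<close>

lemma run_circuit_lift:
  assumes "i < N" "z < q" "w \<in> B" "s \<in> S"
  shows "run_circuit N q C x (map (lift_step dec) ss) \<psi> (i, z, enc (w, s)) =
    run_circuit N q B x ss (\<lambda>(i, z, w). \<psi> (i, z, enc (w, s))) (i, z, w)"
  using assms
proof (induction ss arbitrary: \<psi> i z w)
  case (Cons t ss)
  interpret L: factorization "query_basis N q C" "query_basis N q B" S "lift_dec dec" "lift_enc enc"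
    by (rule factorization_lift)
  let ?\<phi> = "apply_op (query_basis N q C) (step_op q x (lift_step dec t)) \<psi>"
  have step: "?\<phi> (i, z, enc (w, s)) =
      apply_op (query_basis N q B) (step_op q x t) (\<lambda>(i, z, w). \<psi> (i, z, enc (w, s))) (i, z, w)"
    if iz: "i < N" "z < q" "w \<in> B" for i z w
  proof (cases t)
    case (Gate U)
    have "apply_op (query_basis N q C) (block_op (lift_dec dec) (\<lambda>_. U)) \<psi> (lift_enc enc ((i, z, w), s))
        = apply_op (query_basis N q B) U (\<lambda>b'. \<psi> (lift_enc enc (b', s))) (i, z, w)"
      using iz Cons.prems by (intro L.apply_block_op) (auto simp: query_basis_def)
    moreover have "(\<lambda>b'. \<psi> (lift_enc enc (b', s))) = (\<lambda>(i, z, w). \<psi> (i, z, enc (w, s)))"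
      by (auto simp: lift_enc_def)
    ultimately show ?thesis using Gate by (simp add: lift_enc_def)
  next
    case Query
    then show ?thesis
      using iz Cons.prems finite_C finite_B enc_in by (simp add: apply_query_op)
  qed
  have "run_circuit N q C x (map (lift_step dec) (t # ss)) \<psi> (i, z, enc (w, s)) =
      run_circuit N q B x ss (\<lambda>(i, z, w). ?\<phi> (i, z, enc (w, s))) (i, z, w)"
    using Cons.IH[OF Cons.prems] by simp
  also have "\<dots> = run_circuit N q B x ss
      (apply_op (query_basis N q B) (step_op q x t) (\<lambda>(i, z, w). \<psi> (i, z, enc (w, s)))) (i, z, w)"
    using Cons.prems step by (intro run_circuit_cong) (auto simp: query_basis_def)
  finally show ?case by simp
qed simp

end

subsection \<open>Substituting an evaluation circuit for the queries\<close>

text \<open>Both liftings used in the substitution are tensor products with an identity, so their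
  unitarity and action follow from \<open>factorization\<close>.\<close>

lemma lift_outer_eq_block_op:
  "lift_outer U = block_op (\<lambda>(j, y, ((i, z, v), w)). ((i, z, w), (j, y, v))) (\<lambda>_. U)"
  by (intro ext) (auto simp: block_op_def)

lemma lift_inner_eq_block_op: "lift_inner U = block_op (lift_dec id) (\<lambda>_. U)"
  by (intro ext) (auto simp: block_op_def lift_dec_def)

lemma lift_inner_step_eq_lift_step: "lift_inner_step = lift_step id"
proof
  show "lift_inner_step s = lift_step id s" for s :: "'e qstep"
    by (cases s) (simp_all add: lift_inner_eq_block_op)
qed

lemma factorization_id: "finite B \<Longrightarrow> finite S \<Longrightarrow> factorization (B \<times> S) B S id id"
  by unfold_locales auto

lemma output_prob_alt:
  assumes "finite (qa_work A)"
  shows "output_prob N q A x P =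
    (\<Sum>b\<in>query_basis N q (qa_work A). if P (qa_output A b) then (cmod (final_state N q A x b))\<^sup>2 else 0)"
  unfolding output_prob_def using assms by (simp add: sum.If_cases finite_query_basis Int_def)

lemma query_count_with_evaluation:
  "query_count (qa_steps (with_evaluation n A V v0 E)) = query_count (qa_steps A) * query_count E"
proof -
  have "query_count (concat (map (substitute_step E) ss)) = query_count ss * query_count E"
    for ss :: "'w qstep list"
  proof (induction ss)
    case (Cons s ss)
    then show ?case
      by (cases s)
        (auto simp: query_count_def lift_inner_step_eq_lift_step query_count_lift_step[unfolded query_count_def])
  qed (simp add: query_count_def)
  then show ?thesis by (simp add: with_evaluation_def)
qed

locale evaluated_algorithm =
  fixes N q :: nat and X :: "(nat \<Rightarrow> nat) set" and n :: nat
    and f :: "(nat \<Rightarrow> nat) \<Rightarrow> nat \<Rightarrow> nat"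
    and V :: "'v set" and v0 :: 'v and E :: "(nat \<times> nat \<times> 'v) qstep list"
    and A :: "('w, 'o) qalgorithm"
  assumes eval: "coherent_evaluation N q X n f V v0 E" and alg: "query_algorithm n 3 A"
begin

abbreviation VE :: "(nat \<times> nat \<times> 'v) set" where "VE \<equiv> {..<n} \<times> {..<3} \<times> V"
abbreviation "WE \<equiv> VE \<times> qa_work A"
abbreviation "big \<equiv> query_basis N q WE"
abbreviation "small \<equiv> query_basis n 3 (qa_work A)"

lemma fin: "finite (qa_work A)" "finite V" "finite VE" "finite WE"
proof -
  show "finite (qa_work A)" "finite V"
    using eval alg by (auto simp: coherent_evaluation_def query_algorithm_def valid_circuit_def)
  then show "finite VE" and "finite WE" by (auto intro!: finite_cartesian_product)
qed

lemma pos: "0 < N" "0 < q" "0 < n" "v0 \<in> V"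
  using eval alg by (auto simp: coherent_evaluation_def query_algorithm_def valid_circuit_def)

sublocale outer: factorization big small "{..<N} \<times> {..<q} \<times> V"
  "\<lambda>(j, y, ((i, z, v), w)). ((i, z, w), (j, y, v))"
  "\<lambda>((i, z, w), (j, y, v)). (j, y, ((i, z, v), w))"
  by unfold_locales (use fin in \<open>auto simp: query_basis_def\<close>)

sublocale inner: factorization WE VE "qa_work A" id id
  using fin by (intro factorization_id)

text \<open>The invariant between two steps of the outer algorithm: the private registers of
  \<open>E\<close> are back in their initial state.\<close>

definition emb :: "'w qlabel qstate \<Rightarrow> ((nat \<times> nat \<times> 'v) \<times> 'w) qlabel qstate" where
  "emb \<phi> = (\<lambda>(j, y, ((i, z, v), w)). if j = 0 \<and> y = 0 \<and> v = v0 then \<phi> (i, z, w) else 0)"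

text \<open>Coherent evaluation is given on basis states only. Expanding the state over
  \<open>(i, z)\<close> for fixed \<open>w\<close> extends it by linearity; \<open>z1\<close> is the
  preimage of \<open>z\<close> under the query.\<close>

lemma run_evaluation:
  assumes x: "x \<in> X" and b: "i < n" "z < 3" "w \<in> qa_work A" "v \<in> V" "j < N" "y < q"
  shows "run_circuit N q WE x (map lift_inner_step E) (emb \<phi>) (j, y, ((i, z, v), w)) =
    emb (apply_op small (query_op 3 (f x)) \<phi>) (j, y, ((i, z, v), w))"
proof -
  define z1 where "z1 = (z + (3 - f x i mod 3)) mod 3"
  have z1: "z1 < 3" by (simp add: z1_def)
  have query: "apply_op small (query_op 3 (f x)) \<phi> (i, z, w) = \<phi> (i, z1, w)"
    unfolding z1_def using b(1-3) fin(1) by (rule_tac apply_query_op)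
  have fx: "run_circuit N q VE x E (ket (0, 0, (i', z', v0))) (j, y, (i, z, v)) =
      ket (0, 0, (i', (z' + f x i') mod 3, v0)) (j, y, (i, z, v))" if "i' < n" "z' < 3" for i' z'
    using eval x b that by (auto simp: coherent_evaluation_def query_basis_def)
  have "run_circuit N q WE x (map lift_inner_step E) (emb \<phi>) (j, y, ((i, z, v), w)) =
      run_circuit N q VE x E (\<lambda>(j, y, e). emb \<phi> (j, y, (e, w))) (j, y, (i, z, v))"
    using inner.run_circuit_lift[of j N y q "(i, z, v)" w x E "emb \<phi>"] b
    by (simp add: lift_inner_step_eq_lift_step)
  also have "\<dots> = run_circuit N q VE x E
      (\<lambda>b. \<Sum>p\<in>{..<n} \<times> {..<3}. \<phi> (fst p, snd p, w) * ket (0, 0, (fst p, snd p, v0)) b) (j, y, (i, z, v))"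
  proof (rule run_circuit_cong)
    fix b :: "(nat \<times> nat \<times> 'v) qlabel" assume "b \<in> query_basis N q VE"
    then obtain j y i z v where b: "b = (j, y, (i, z, v))" "i < n" "z < 3"
      by (auto simp: query_basis_def)
    have "(\<Sum>p\<in>{..<n} \<times> {..<3}. \<phi> (fst p, snd p, w) * ket (0, 0, (fst p, snd p, v0)) b) =
        (\<Sum>p\<in>{..<n} \<times> {..<3}. if p = (i, z) then emb \<phi> (j, y, ((i, z, v), w)) else 0)"
      using b by (intro sum.cong) (auto simp: ket_def emb_def)
    also have "\<dots> = emb \<phi> (j, y, ((i, z, v), w))"
      using b by (subst sum.delta) auto
    finally show "(case b of (j, y, e) \<Rightarrow> emb \<phi> (j, y, (e, w))) =
        (\<Sum>p\<in>{..<n} \<times> {..<3}. \<phi> (fst p, snd p, w) * ket (0, 0, (fst p, snd p, v0)) b)"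
      using b by simp
  qed (use b in \<open>auto simp: query_basis_def\<close>)
  also have "\<dots> = (\<Sum>p\<in>{..<n} \<times> {..<3}. \<phi> (fst p, snd p, w) *
      ket (0, 0, (fst p, (snd p + f x (fst p)) mod 3, v0)) (j, y, (i, z, v)))"
    unfolding run_circuit_sum by (intro sum.cong refl) (auto simp: fx)
  also have "\<dots> = (\<Sum>p\<in>{..<n} \<times> {..<3}. if p = (i, z1) then
      (if j = 0 \<and> y = 0 \<and> v = v0 then \<phi> (i, z1, w) else 0) else 0)"
  proof (intro sum.cong refl)
    fix p :: "nat \<times> nat" assume "p \<in> {..<n} \<times> {..<3}"
    then have "z = (snd p + f x i) mod 3 \<longleftrightarrow> snd p = z1"
      unfolding z1_def using b by (intro eq_add_mod_iff) auto
    then show "\<phi> (fst p, snd p, w) * ket (0, 0, (fst p, (snd p + f x (fst p)) mod 3, v0)) (j, y, (i, z, v)) =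
      (if p = (i, z1) then (if j = 0 \<and> y = 0 \<and> v = v0 then \<phi> (i, z1, w) else 0) else 0)"
      by (cases p) (auto simp: ket_def)
  qed
  also have "\<dots> = emb (apply_op small (query_op 3 (f x)) \<phi>) (j, y, ((i, z, v), w))"
    using b(1) z1 by (subst sum.delta) (simp_all add: emb_def query)
  finally show ?thesis .
qed

lemma run_substitute:
  assumes x: "x \<in> X" and "b \<in> big"
  shows "run_circuit N q WE x (concat (map (substitute_step E) ss)) (emb \<phi>) b =
    emb (run_circuit n 3 (qa_work A) (f x) ss \<phi>) b"
  using assms(2)
proof (induction ss arbitrary: \<phi>)
  case (Cons s ss)
  have step: "run_circuit N q WE x (substitute_step E s) (emb \<phi>) b =
      emb (apply_op small (step_op 3 (f x) s) \<phi>) b" if b: "b \<in> big" for b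
  proof -
    obtain j y i z v w where b': "b = (j, y, ((i, z, v), w))" "i < n" "z < 3" "w \<in> qa_work A"
        "v \<in> V" "j < N" "y < q"
      using b by (auto simp: query_basis_def)
    show ?thesis
    proof (cases s)
      case (Gate U)
      have "apply_op big (lift_outer U) (emb \<phi>) b =
          apply_op small U (\<lambda>b'. emb \<phi> ((\<lambda>((i, z, w), (j, y, v)). (j, y, ((i, z, v), w))) (b', (j, y, v)))) (i, z, w)"
        unfolding lift_outer_eq_block_op
        using outer.apply_block_op[of "(i, z, w)" "(j, y, v)" "\<lambda>_. U" "emb \<phi>"] b'
        by (simp add: query_basis_def)
      also have "\<dots> = emb (apply_op small U \<phi>) b"
        by (cases "j = 0 \<and> y = 0 \<and> v = v0") (auto simp: b'(1) emb_def apply_op_def intro!: sum.cong sum.neutral)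
      finally show ?thesis using Gate by simp
    next
      case Query
      then show ?thesis using run_evaluation[OF x b'(2-7), of \<phi>] by (simp add: b'(1))
    qed
  qed
  have "run_circuit N q WE x (concat (map (substitute_step E) (s # ss))) (emb \<phi>) b =
      run_circuit N q WE x (concat (map (substitute_step E) ss))
        (emb (apply_op small (step_op 3 (f x) s) \<phi>)) b"
    by simp (intro run_circuit_cong step Cons.prems)
  also have "\<dots> = emb (run_circuit n 3 (qa_work A) (f x) ss (apply_op small (step_op 3 (f x) s) \<phi>)) b"
    by (rule Cons.IH[OF Cons.prems])
  finally show ?case by simp
qed simp

lemma valid: "query_algorithm N q (with_evaluation n A V v0 E)"
proof -
  have E: "valid_circuit N q WE (map lift_inner_step E)"
    unfolding lift_inner_step_eq_lift_step
    using eval by (intro inner.valid_circuit_lift) (auto simp: coherent_evaluation_def)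
  have "unitary_on big U" if U: "Gate U \<in> set (concat (map (substitute_step E) (qa_steps A)))" for U
  proof -
    obtain s where s: "s \<in> set (qa_steps A)" "Gate U \<in> set (substitute_step E s)"
      using U by auto
    show ?thesis
    proof (cases s)
      case (Gate U')
      then have "U = lift_outer U'" "unitary_on small U'"
        using s alg by (auto simp: query_algorithm_def valid_circuit_def)
      then show ?thesis
        unfolding lift_outer_eq_block_op by (auto intro: outer.unitary_block_op)
    next
      case Query
      then show ?thesis using s E by (auto simp: valid_circuit_def)
    qed
  qed
  moreover have "qa_start A \<in> qa_work A" using alg by (simp add: query_algorithm_def)
  ultimately show ?thesis
    using pos fin(4) by (simp add: query_algorithm_def valid_circuit_def with_evaluation_def)
qed

text \<open>Amplitudes vanish unless the registers of \<open>E\<close> are in their initial state,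
  so the measurement sum collapses to that block. The restriction moves \<open>f x\<close> into the
  extensional function space of the inputs; values from \<open>n\<close> on are never read.\<close>

lemma output_prob_with_evaluation:
  assumes "x \<in> X"
  shows "output_prob N q (with_evaluation n A V v0 E) x P =
    output_prob n 3 A (restrict (f x) {..<n}) P"
proof -
  let ?D = "\<lambda>(j, y, ((i, z, v), w)). ((i, z, w), (j, y, v))"
  have run_restrict: "run_circuit n 3 (qa_work A) (f x) ss \<phi> b =
      run_circuit n 3 (qa_work A) (restrict (f x) {..<n}) ss \<phi> b" if "b \<in> small" for ss \<phi> b
    using that
  proof (induction ss arbitrary: \<phi>)
    case (Cons s ss)
    have "apply_op small (step_op 3 (f x) s) \<phi> b = apply_op small (step_op 3 (restrict (f x) {..<n}) s) \<phi> b"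
      if b: "b \<in> small" for b
    proof -
      obtain i z w where "b = (i, z, w)" "i < n" "z < 3" "w \<in> qa_work A"
        using b by (auto simp: query_basis_def)
      then show ?thesis using fin by (cases s) (simp_all add: apply_query_op)
    qed
    then have "run_circuit n 3 (qa_work A) (restrict (f x) {..<n}) ss
          (apply_op small (step_op 3 (f x) s) \<phi>) b =
        run_circuit n 3 (qa_work A) (restrict (f x) {..<n}) ss
          (apply_op small (step_op 3 (restrict (f x) {..<n}) s) \<phi>) b"
      using Cons.prems by (intro run_circuit_cong) auto
    then show ?case using Cons by (simp del: restrict_apply)
  qed simp
  have start: "ket (0, 0, qa_start (with_evaluation n A V v0 E)) = emb (ket (0, 0, qa_start A))"
    by (auto simp: with_evaluation_def emb_def ket_def)
  have fs: "final_state N q (with_evaluation n A V v0 E) x b = emb (final_state n 3 A (restrict (f x) {..<n})) b"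
    if b: "b \<in> big" for b
  proof -
    have "final_state N q (with_evaluation n A V v0 E) x b =
        emb (run_circuit n 3 (qa_work A) (f x) (qa_steps A) (ket (0, 0, qa_start A))) b"
      using run_substitute[OF assms b] start by (simp add: final_state_def with_evaluation_def)
    also have "\<dots> = emb (final_state n 3 A (restrict (f x) {..<n})) b"
      using b run_restrict by (auto simp: emb_def final_state_def query_basis_def)
    finally show ?thesis .
  qed
  let ?F = "\<lambda>b. if P (qa_output A b) then (cmod (final_state n 3 A (restrict (f x) {..<n}) b))\<^sup>2 else 0"
  have "output_prob N q (with_evaluation n A V v0 E) x P =
      (\<Sum>b\<in>big. if (0, 0, v0) = snd (?D b) then ?F (fst (?D b)) else 0)"
    using fin
    by (subst output_prob_alt) (auto simp: with_evaluation_def fs[unfolded with_evaluation_def]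
        emb_def case_prod_beta intro!: sum.cong)
  also have "\<dots> = (\<Sum>b\<in>small. ?F b)"
    using pos by (subst outer.sum_block) (auto simp: query_basis_def intro!: sum.cong)
  also have "\<dots> = output_prob n 3 A (restrict (f x) {..<n}) P"
    using fin by (subst output_prob_alt) auto
  finally show ?thesis .
qed

end

subsection \<open>Sequential composition with fresh registers\<close>

lemma output_prob_nonneg: "0 \<le> output_prob N q A x P"
  unfolding output_prob_def by (intro sum_nonneg) auto

lemma sum_final_state:
  assumes "query_algorithm N q A"
  shows "(\<Sum>b\<in>query_basis N q (qa_work A). (cmod (final_state N q A x b))\<^sup>2) = 1"
proof -
  have *: "valid_circuit N q (qa_work A) (qa_steps A)" "qa_start A \<in> qa_work A"
    using assms by (auto simp: query_algorithm_def)
  then have "(0, 0, qa_start A) \<in> query_basis N q (qa_work A)" "finite (query_basis N q (qa_work A))"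
    by (auto simp: valid_circuit_def query_basis_def)
  moreover have "(\<Sum>b\<in>query_basis N q (qa_work A). (cmod (final_state N q A x b))\<^sup>2) =
      (\<Sum>b\<in>query_basis N q (qa_work A). if b = (0, 0, qa_start A) then 1 else 0)"
    unfolding final_state_def run_circuit_norm[OF *(1)]
    by (intro sum.cong) (auto simp: ket_def)
  ultimately show ?thesis by simp
qed

lemma output_prob_add_not:
  assumes "query_algorithm N q A"
  shows "output_prob N q A x P + output_prob N q A x (\<lambda>a. \<not> P a) = 1"
proof -
  have "finite (qa_work A)" using assms by (simp add: query_algorithm_def valid_circuit_def)
  then show ?thesis
    unfolding sum_final_state[OF assms, of x, symmetric]
    by (simp add: output_prob_alt sum.distrib[symmetric]) (intro sum.cong, auto)
qed

lemma output_prob_le_1: "query_algorithm N q A \<Longrightarrow> output_prob N q A x P \<le> 1"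
  using output_prob_add_not[of N q A x P] output_prob_nonneg[of N q A x "\<lambda>a. \<not> P a"] by linarith

text \<open>Each composition enlarges the type of work labels, whereas \<open>realizable\<close> and
  the final statement quantify over algorithms of a single type. Encoding labels as naturals closes
  that gap.\<close>

lemma relabel_algorithm:
  fixes A :: "('w, 'o) qalgorithm" and g :: "'w \<Rightarrow> 'u"
  assumes A: "query_algorithm N q A" and g: "inj g"
  obtains A' :: "('u, 'o) qalgorithm" where "query_algorithm N q A'"
    "query_count (qa_steps A') = query_count (qa_steps A)"
    "\<And>x P. output_prob N q A' x P = output_prob N q A x P"
proof -
  define dec where "dec = (\<lambda>u. (inv g u, ()))"
  define enc where "enc = (\<lambda>(w, _::unit). g w)"
  define A' :: "('u, 'o) qalgorithm" where
    "A' = \<lparr> qa_work = g ` qa_work A, qa_start = g (qa_start A),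
            qa_steps = map (lift_step dec) (qa_steps A),
            qa_output = (\<lambda>(i, z, u). qa_output A (i, z, inv g u)) \<rparr>"
  have fin: "finite (qa_work A)" using A by (simp add: query_algorithm_def valid_circuit_def)
  interpret F: factorization "g ` qa_work A" "qa_work A" UNIV dec enc
    by unfold_locales (use fin g in \<open>auto simp: dec_def enc_def\<close>)
  interpret L: factorization "query_basis N q (g ` qa_work A)" "query_basis N q (qa_work A)" UNIV
      "lift_dec dec" "lift_enc enc"
    by (rule F.factorization_lift)
  have alg: "query_algorithm N q A'"
    using A F.valid_circuit_lift by (auto simp: query_algorithm_def A'_def)
  have fs: "final_state N q A' x (i, z, g w) = final_state N q A x (i, z, w)"
    if "(i, z, w) \<in> query_basis N q (qa_work A)" for x i z w
  proof -
    have "final_state N q A' x (i, z, g w) = run_circuit N q (qa_work A) x (qa_steps A)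
       (\<lambda>(i, z, w). ket (0, 0, g (qa_start A)) (i, z, enc (w, ()))) (i, z, w)"
      using F.run_circuit_lift[of i N z q w "()" x "qa_steps A" "ket (0, 0, g (qa_start A))"] that
      by (simp add: final_state_def A'_def enc_def query_basis_def)
    also have "(\<lambda>(i, z, w). ket (0, 0, g (qa_start A)) (i, z, enc (w, ()))) = ket (0, 0, qa_start A)"
      using g by (auto simp: ket_def enc_def inj_eq)
    finally show ?thesis by (simp add: final_state_def)
  qed
  show thesis
  proof
    show "query_algorithm N q A'" by (rule alg)
    show "query_count (qa_steps A') = query_count (qa_steps A)" by (simp add: A'_def)
    fix x P
    have "output_prob N q A' x P = (\<Sum>b\<in>query_basis N q (qa_work A).
        if P (qa_output A b) then (cmod (final_state N q A x b))\<^sup>2 else 0)"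
      using fin g
      by (subst output_prob_alt) (auto simp: A'_def L.sum_factorization UNIV_unit lift_enc_def enc_def
          fs[unfolded A'_def] intro!: sum.cong)
    then show "output_prob N q A' x P = output_prob N q A x P"
      using fin by (simp add: output_prob_alt)
  qed
qed

text \<open>The second algorithm needs its query registers back in the state \<open>(0, 0)\<close>, so they are
  exchanged with a stored pair of zeros.\<close>

definition swap_registers :: "('a \<times> 'b \<times> nat \<times> nat) qlabel \<Rightarrow> ('a \<times> 'b \<times> nat \<times> nat) qlabel" where
  "swap_registers = (\<lambda>(i, z, (a, b, i', z')). (i', z', (a, b, i, z)))"

text \<open>Both algorithms run in full and nothing is measured in between; the choice between their
  answers is left to the output function.\<close>

definition try_in_order ::
  "nat \<Rightarrow> nat \<Rightarrow> ('a, 'o option) qalgorithm \<Rightarrow> ('b, 'o option) qalgorithm \<Rightarrow>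
    ('a \<times> 'b \<times> nat \<times> nat, 'o option) qalgorithm"
where
  "try_in_order N q A B =
    \<lparr> qa_work = qa_work A \<times> qa_work B \<times> {..<N} \<times> {..<q},
      qa_start = (qa_start A, qa_start B, 0, 0),
      qa_steps = map (lift_step (\<lambda>(a, b, i, z). (a, (b, i, z)))) (qa_steps A)
        @ [Gate (\<lambda>c c'. if c = swap_registers c' then 1 else 0)]
        @ map (lift_step (\<lambda>(a, b, i, z). (b, (a, i, z)))) (qa_steps B),
      qa_output = (\<lambda>(i, z, (a, b, i', z')).
        case qa_output A (i', z', a) of None \<Rightarrow> qa_output B (i, z, b) | Some y \<Rightarrow> Some y) \<rparr>"

lemma query_count_try_in_order:
  "query_count (qa_steps (try_in_order N q A B)) = query_count (qa_steps A) + query_count (qa_steps B)"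
  unfolding try_in_order_def by (simp add: query_count_def query_count_lift_step[unfolded query_count_def])

locale two_algorithms =
  fixes N q :: nat and A :: "('a, 'o option) qalgorithm" and B :: "('b, 'o option) qalgorithm"
  assumes A: "query_algorithm N q A" and B: "query_algorithm N q B"
begin

abbreviation "W \<equiv> qa_work A \<times> qa_work B \<times> {..<N} \<times> {..<q}"
abbreviation "AB \<equiv> try_in_order N q A B"

lemma fin: "finite (qa_work A)" "finite (qa_work B)" "finite W" and pos: "0 < N" "0 < q"
  using A B by (auto simp: query_algorithm_def valid_circuit_def)

sublocale first: factorization W "qa_work A" "qa_work B \<times> {..<N} \<times> {..<q}"
  "\<lambda>(a, b, i, z). (a, (b, i, z))" "\<lambda>(a, (b, i, z)). (a, b, i, z)"
  by unfold_locales (use fin in auto)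

sublocale second: factorization W "qa_work B" "qa_work A \<times> {..<N} \<times> {..<q}"
  "\<lambda>(a, b, i, z). (b, (a, i, z))" "\<lambda>(b, (a, i, z)). (a, b, i, z)"
  by unfold_locales (use fin in auto)

sublocale both: factorization "query_basis N q W" "query_basis N q (qa_work A)" "query_basis N q (qa_work B)"
  "\<lambda>(i, z, (a, b, i', z')). ((i', z', a), (i, z, b))"
  "\<lambda>((i', z', a), (i, z, b)). (i, z, (a, b, i', z'))"
  by unfold_locales (use fin in \<open>auto simp: query_basis_def\<close>)

lemma bij_swap: "bij_betw swap_registers (query_basis N q W) (query_basis N q W)"
  by (rule bij_betw_byWitness[where f' = swap_registers]) (auto simp: swap_registers_def query_basis_def)

lemma valid: "query_algorithm N q AB"
proof -
  have U: "unitary_on (query_basis N q W) (\<lambda>c c'. if c = swap_registers c' then 1 else 0)"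
    using fin by (intro unitary_on_permutation[OF _ bij_swap]) (auto simp: finite_query_basis)
  show ?thesis
    using A B U first.valid_circuit_lift[of N q "qa_steps A"] second.valid_circuit_lift[of N q "qa_steps B"] pos
    by (auto simp: query_algorithm_def try_in_order_def valid_circuit_def)
qed

text \<open>The swap parks the query registers of the first algorithm in the slots
  \<open>(i', z')\<close>, so the second starts from a clean state and the result is a product
  state.\<close>

lemma final_state_try_in_order:
  assumes b: "(i, z, (a, b, i', z')) \<in> query_basis N q W"
  shows "final_state N q AB x (i, z, (a, b, i', z')) =
    final_state N q A x (i', z', a) * final_state N q B x (i, z, b)"
proof -
  let ?Q = "query_basis N q W"
  let ?\<psi>0 = "ket (0, 0, (qa_start A, qa_start B, 0, 0))"
  define \<psi>1 where "\<psi>1 = run_circuit N q W x (map (lift_step (\<lambda>(a, b, i, z). (a, (b, i, z)))) (qa_steps A)) ?\<psi>0"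
  define \<psi>2 where "\<psi>2 = apply_op ?Q (\<lambda>c c'. if c = swap_registers c' then 1 else 0) \<psi>1"
  have \<psi>1: "\<psi>1 (i, z, (a, b, i', z')) =
      (if b = qa_start B \<and> i' = 0 \<and> z' = 0 then 1 else 0) * final_state N q A x (i, z, a)"
    if "(i, z, (a, b, i', z')) \<in> ?Q" for i z a b i' z'
  proof -
    let ?m = "if b = qa_start B \<and> i' = 0 \<and> z' = 0 then 1 else 0 :: complex"
    have "\<psi>1 (i, z, (a, b, i', z')) = run_circuit N q (qa_work A) x (qa_steps A)
        (\<lambda>(i, z, a). ?\<psi>0 (i, z, (a, b, i', z'))) (i, z, a)"
      using first.run_circuit_lift[of i N z q a "(b, i', z')" x "qa_steps A" ?\<psi>0] that
      by (simp add: \<psi>1_def query_basis_def)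
    also have "(\<lambda>(i, z, a). ?\<psi>0 (i, z, (a, b, i', z'))) = (\<lambda>c. ?m * ket (0, 0, qa_start A) c)"
      by (auto simp: ket_def)
    finally show ?thesis by (simp add: run_circuit_scale final_state_def)
  qed
  have \<psi>2: "\<psi>2 c = \<psi>1 (swap_registers c)" if c: "c \<in> ?Q" for c
  proof -
    have s: "c = swap_registers c' \<longleftrightarrow> c' = swap_registers c" for c'
      by (auto simp: swap_registers_def split: prod.splits)
    have "\<psi>2 c = (\<Sum>c'\<in>?Q. if c' = swap_registers c then \<psi>1 c' else 0)"
      unfolding \<psi>2_def apply_op_def s by (intro sum.cong) auto
    also have "\<dots> = \<psi>1 (swap_registers c)"
      using bij_swap c fin by (subst sum.delta) (auto simp: bij_betw_def finite_query_basis)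
    finally show ?thesis .
  qed
  have "final_state N q AB x (i, z, (a, b, i', z')) =
      run_circuit N q W x (map (lift_step (\<lambda>(a, b, i, z). (b, (a, i, z)))) (qa_steps B)) \<psi>2 (i, z, (a, b, i', z'))"
    by (simp add: final_state_def try_in_order_def \<psi>2_def \<psi>1_def)
  also have "\<dots> = run_circuit N q (qa_work B) x (qa_steps B) (\<lambda>(i, z, b). \<psi>2 (i, z, (a, b, i', z'))) (i, z, b)"
    using second.run_circuit_lift[of i N z q b "(a, i', z')" x "qa_steps B" \<psi>2] b
    by (simp add: query_basis_def)
  also have "\<dots> = run_circuit N q (qa_work B) x (qa_steps B)
      (\<lambda>c. final_state N q A x (i', z', a) * ket (0, 0, qa_start B) c) (i, z, b)"
    using b by (intro run_circuit_cong)
      (auto simp: query_basis_def \<psi>2 \<psi>1 swap_registers_def ket_def split: if_splits)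
  also have "\<dots> = final_state N q A x (i', z', a) * final_state N q B x (i, z, b)"
    by (simp add: run_circuit_scale final_state_def)
  finally show ?thesis .
qed

lemma output_prob_try_in_order:
  "output_prob N q AB x P = (\<Sum>c\<in>query_basis N q (qa_work A). \<Sum>d\<in>query_basis N q (qa_work B).
     if P (case qa_output A c of None \<Rightarrow> qa_output B d | Some y \<Rightarrow> Some y)
     then (cmod (final_state N q A x c))\<^sup>2 * (cmod (final_state N q B x d))\<^sup>2 else 0)"
proof -
  have W: "qa_work AB = W" by (simp add: try_in_order_def)
  have "output_prob N q AB x P = (\<Sum>b\<in>query_basis N q W.
      if P (qa_output AB b) then (cmod (final_state N q AB x b))\<^sup>2 else 0)"
    using output_prob_alt[of AB N q x P] fin W by simp
  also have "\<dots> = (\<Sum>c\<in>query_basis N q (qa_work A). \<Sum>d\<in>query_basis N q (qa_work B).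
     if P (case qa_output A c of None \<Rightarrow> qa_output B d | Some y \<Rightarrow> Some y)
     then (cmod (final_state N q A x c))\<^sup>2 * (cmod (final_state N q B x d))\<^sup>2 else 0)"
    unfolding both.sum_factorization
  proof (intro sum.cong refl, goal_cases)
    case (1 c d)
    then obtain i z a i' z' b where c: "c = (i', z', a)" and d: "d = (i, z, b)"
        and "(i, z, (a, b, i', z')) \<in> query_basis N q W"
      by (auto simp: query_basis_def)
    then show ?case
      unfolding c d by (simp add: final_state_try_in_order norm_mult power_mult_distrib) (simp add: try_in_order_def)
  qed
  finally show ?thesis .
qed

lemma prob_None_try_in_order:
  "output_prob N q AB x (\<lambda>y. y = None) =
     output_prob N q A x (\<lambda>y. y = None) * output_prob N q B x (\<lambda>y. y = None)"
  unfolding output_prob_try_in_order using fin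
  by (auto simp: output_prob_alt sum_product intro!: sum.cong split: option.split)

text \<open>A union bound: a pair returned by the combination was returned by one of the two
  algorithms.\<close>

lemma prob_Some_try_in_order:
  "output_prob N q AB x (\<lambda>y. y \<noteq> None \<and> P y) \<le>
     output_prob N q A x (\<lambda>y. y \<noteq> None \<and> P y) + output_prob N q B x (\<lambda>y. y \<noteq> None \<and> P y)"
proof -
  let ?a = "\<lambda>c. (cmod (final_state N q A x c))\<^sup>2" and ?b = "\<lambda>c. (cmod (final_state N q B x c))\<^sup>2"
  let ?p = "\<lambda>c. if qa_output A c \<noteq> None \<and> P (qa_output A c) then ?a c else 0"
  let ?r = "\<lambda>c. if qa_output B c \<noteq> None \<and> P (qa_output B c) then ?b c else 0"
  have "output_prob N q AB x (\<lambda>y. y \<noteq> None \<and> P y) \<le>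
      (\<Sum>c\<in>query_basis N q (qa_work A). \<Sum>d\<in>query_basis N q (qa_work B). ?p c * ?b d + ?a c * ?r d)"
    unfolding output_prob_try_in_order by (intro sum_mono) (auto split: option.splits)
  also have "\<dots> = (\<Sum>c\<in>query_basis N q (qa_work A). ?p c) * (\<Sum>d\<in>query_basis N q (qa_work B). ?b d) +
      (\<Sum>c\<in>query_basis N q (qa_work A). ?a c) * (\<Sum>d\<in>query_basis N q (qa_work B). ?r d)"
    by (simp only: sum.distrib sum_product)
  finally show ?thesis
    using fin by (simp add: sum_final_state[OF A] sum_final_state[OF B] output_prob_alt)
qed

end

subsection \<open>Projections and reflections\<close>

lemma sum_symmetric_matrix:
  fixes M :: "'e \<Rightarrow> 'e \<Rightarrow> real"
  assumes "\<And>a b. M a b = M b a"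
  shows "(\<Sum>a\<in>E. (\<Sum>b\<in>E. M a b * x b) * y a) = (\<Sum>a\<in>E. x a * (\<Sum>b\<in>E. M a b * y b))"
proof -
  have "(\<Sum>a\<in>E. (\<Sum>b\<in>E. M a b * x b) * y a) = (\<Sum>a\<in>E. \<Sum>b\<in>E. x b * (M b a * y a))"
    unfolding sum_distrib_right using assms by (intro sum.cong refl) simp
  also have "\<dots> = (\<Sum>a\<in>E. x a * (\<Sum>b\<in>E. M a b * y b))"
    by (subst sum.swap) (simp add: sum_distrib_left)
  finally show ?thesis .
qed

definition projection_on :: "'e set \<Rightarrow> ('e \<Rightarrow> 'e \<Rightarrow> real) \<Rightarrow> bool" where
  "projection_on E R \<longleftrightarrow> (\<forall>a b. R a b = R b a) \<and>
     (\<forall>a\<in>E. \<forall>b\<in>E. (\<Sum>c\<in>E. R a c * R c b) = R a b)"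

lemma projection_on_idem:
  assumes "projection_on E R" "a \<in> E"
  shows "(\<Sum>c\<in>E. R a c * (\<Sum>b\<in>E. R c b * v b)) = (\<Sum>b\<in>E. R a b * v b)"
proof -
  have "(\<Sum>c\<in>E. R a c * (\<Sum>b\<in>E. R c b * v b)) = (\<Sum>c\<in>E. \<Sum>b\<in>E. R a c * R c b * v b)"
    by (simp add: sum_distrib_left mult.assoc)
  also have "\<dots> = (\<Sum>b\<in>E. (\<Sum>c\<in>E. R a c * R c b) * v b)"
    by (subst sum.swap) (simp add: sum_distrib_right)
  also have "\<dots> = (\<Sum>b\<in>E. R a b * v b)"
    using assms by (intro sum.cong) (auto simp: projection_on_def)
  finally show ?thesis .
qed

text \<open>Gram-Schmidt, one vector at a time: the residual \<open>r\<close> of the new vector is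
  orthogonal to the range so far, and its normalized outer product is added to \<open>R\<close>. The
  two clauses after \<open>projection_on\<close> characterize, on \<open>E\<close>, the orthogonal
  projection onto the span of \<open>U\<close>.\<close>

lemma projection_exists:
  fixes U :: "('e \<Rightarrow> real) set"
  assumes "finite U" "finite E"
  shows "\<exists>R. projection_on E R \<and> (\<forall>u\<in>U. \<forall>a\<in>E. (\<Sum>b\<in>E. R a b * u b) = u a) \<and>
    (\<forall>g. (\<forall>u\<in>U. (\<Sum>b\<in>E. u b * g b) = 0) \<longrightarrow> (\<forall>a\<in>E. (\<Sum>b\<in>E. R a b * g b) = 0))"
  using assms(1)
proof (induction U rule: finite_induct)
  case empty
  show ?case by (rule exI[of _ "\<lambda>_ _. 0"]) (auto simp: projection_on_def)
next
  case (insert v U)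
  obtain R where R: "projection_on E R"
    and fixed: "\<forall>u\<in>U. \<forall>a\<in>E. (\<Sum>b\<in>E. R a b * u b) = u a"
    and killed: "\<forall>g. (\<forall>u\<in>U. (\<Sum>b\<in>E. u b * g b) = 0) \<longrightarrow> (\<forall>a\<in>E. (\<Sum>b\<in>E. R a b * g b) = 0)"
    using insert.IH by (elim exE conjE)
  have sym: "R a b = R b a" for a b using R by (auto simp: projection_on_def)
  define r where "r a = v a - (\<Sum>b\<in>E. R a b * v b)" for a
  define s where "s = (\<Sum>a\<in>E. r a * r a)"
  show ?case
  proof (cases "s = 0")
    case True
    \<comment> \<open>A zero residual means that \<open>v\<close> already lies in the range, so
      \<open>R\<close> can stay.\<close>
    have "r a = 0" if "a \<in> E" for a
      using True that assms(2) unfolding s_def by (subst (asm) sum_nonneg_eq_0_iff) auto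
    then have "\<forall>a\<in>E. (\<Sum>b\<in>E. R a b * v b) = v a" by (simp add: r_def)
    then show ?thesis using R fixed killed by (intro exI[of _ R]) simp
  next
    case False
    define R' where "R' a b = R a b + r a * r b / s" for a b
    have R'_mult: "(\<Sum>b\<in>E. R' a b * g b) = (\<Sum>b\<in>E. R a b * g b) + r a * (\<Sum>b\<in>E. r b * g b) / s" for a g
      by (simp add: R'_def sum.distrib sum_distrib_left sum_divide_distrib algebra_simps)
    have Rr: "(\<Sum>b\<in>E. R a b * r b) = 0" if "a \<in> E" for a
      using projection_on_idem[OF R that, of v] by (simp add: r_def right_diff_distrib sum_subtractf)
    have r_dot: "(\<Sum>b\<in>E. r b * g b) = (\<Sum>b\<in>E. v b * g b) - (\<Sum>b\<in>E. v b * (\<Sum>c\<in>E. R b c * g c))" for g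
      using sum_symmetric_matrix[of R v E g, OF sym] by (simp add: r_def left_diff_distrib sum_subtractf)
    show ?thesis
    proof (intro exI[of _ R'] conjI ballI allI impI)
      show "projection_on E R'"
        unfolding projection_on_def
      proof (intro conjI allI ballI)
        show "R' a b = R' b a" for a b by (simp add: R'_def sym)
        fix a b assume ab: "a \<in> E" "b \<in> E"
        have rR: "(\<Sum>c\<in>E. r c * R c b) = 0"
          using Rr[OF ab(2)] by (simp add: sym[of _ b] mult.commute)
        have "(\<Sum>c\<in>E. R' a c * R' c b) = (\<Sum>c\<in>E. R a c * R' c b) + r a * (\<Sum>c\<in>E. r c * R' c b) / s"
          by (rule R'_mult)
        also have "(\<Sum>c\<in>E. R a c * R' c b) = (\<Sum>c\<in>E. R a c * R c b) + (\<Sum>c\<in>E. R a c * r c) * r b / s"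
          unfolding R'_def sum_distrib_right sum_divide_distrib
          by (simp add: sum.distrib[symmetric] algebra_simps)
        also have "(\<Sum>c\<in>E. r c * R' c b) = (\<Sum>c\<in>E. r c * R c b) + s * r b / s"
          unfolding R'_def s_def sum_distrib_right sum_divide_distrib
          by (simp add: sum.distrib[symmetric] algebra_simps)
        finally have "(\<Sum>c\<in>E. R' a c * R' c b) = (\<Sum>c\<in>E. R a c * R c b) + r a * r b / s"
          using ab False by (simp only: Rr rR) simp
        also have "(\<Sum>c\<in>E. R a c * R c b) = R a b"
          using R ab unfolding projection_on_def by blast
        finally show "(\<Sum>c\<in>E. R' a c * R' c b) = R' a b" by (simp only: R'_def)
      qed
    next
      fix u a assume u: "u \<in> insert v U" and a: "a \<in> E"
      show "(\<Sum>b\<in>E. R' a b * u b) = u a"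
      proof (cases "u = v")
        case True
        have "(\<Sum>b\<in>E. r b * v b) = s"
          using r_dot[of r] Rr by (simp add: s_def mult.commute)
        then show ?thesis using True False by (simp add: R'_mult r_def)
      next
        case False
        then have "u \<in> U" using u by simp
        then show ?thesis using a fixed by (simp add: R'_mult r_dot)
      qed
    next
      fix g a assume g: "\<forall>u\<in>insert v U. (\<Sum>b\<in>E. u b * g b) = 0" and a: "a \<in> E"
      then have "\<forall>a\<in>E. (\<Sum>b\<in>E. R a b * g b) = 0" using killed by simp
      then show "(\<Sum>b\<in>E. R' a b * g b) = 0" using g a by (simp add: R'_mult r_dot)
    qed
  qed
qed

definition reflection :: "('e \<Rightarrow> 'e \<Rightarrow> real) \<Rightarrow> 'e qoperator" where
  "reflection R = (\<lambda>e e'. complex_of_real ((if e = e' then 1 else 0) - 2 * R e e'))"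

lemma unitary_on_reflection:
  assumes "projection_on E R" "finite E"
  shows "unitary_on E (reflection R)"
proof (rule unitary_onI_involution[OF assms(2)])
  show "cnj (reflection R b b') = reflection R b' b" for b b'
    using assms by (simp add: reflection_def projection_on_def)
  fix b b' assume b: "b \<in> E" "b' \<in> E"
  have "(\<Sum>c\<in>E. ((if b = c then 1 else 0) - 2 * R b c) * ((if c = b' then 1 else 0) - 2 * R c b')) =
      (\<Sum>c\<in>E. (if c = b then if b = b' then 1 else 0 else 0) - 2 * (if c = b' then R b b' else 0)
        - 2 * (if c = b then R b b' else 0) + 4 * (R b c * R c b'))"
    by (intro sum.cong) (auto simp: algebra_simps)
  also have "\<dots> = (if b = b' then 1 else 0)"
  proof -
    have "(\<Sum>c\<in>E. R b c * R c b') = R b b'" using b assms(1) unfolding projection_on_def by blast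
    then show ?thesis
      unfolding sum.distrib sum_subtractf sum_distrib_left[symmetric] sum.delta[OF assms(2)]
      using b by simp
  qed
  finally show "(\<Sum>c\<in>E. reflection R b c * reflection R c b') = (if b = b' then 1 else 0)"
    unfolding reflection_def of_real_mult[symmetric] of_real_sum[symmetric] by simp
qed

lemma apply_reflection:
  assumes "finite E" "e \<in> E"
  shows "apply_op E (reflection R) (\<lambda>e. complex_of_real (\<phi> e)) e =
    complex_of_real (\<phi> e - 2 * (\<Sum>e'\<in>E. R e e' * \<phi> e'))"
proof -
  have "(\<Sum>e'\<in>E. ((if e = e' then 1 else 0) - 2 * R e e') * \<phi> e') =
      (\<Sum>e'\<in>E. (if e' = e then \<phi> e else 0) - 2 * (R e e' * \<phi> e'))"
    by (intro sum.cong) (auto simp: algebra_simps)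
  also have "\<dots> = \<phi> e - 2 * (\<Sum>e'\<in>E. R e e' * \<phi> e')"
    unfolding sum_subtractf sum_distrib_left[symmetric] sum.delta[OF assms(1)] using assms by simp
  finally show ?thesis
    unfolding apply_op_def reflection_def of_real_mult[symmetric] of_real_sum[symmetric] by simp
qed

text \<open>\<open>spread T\<close> is the reflection that exchanges the first basis vector with the uniform
  superposition: it is \<open>2 v v\<^sup>T / \<bar>v\<bar>\<^sup>2 - 1\<close> for the sum \<open>v\<close> of the two.\<close>

definition spread :: "nat \<Rightarrow> nat \<Rightarrow> nat \<Rightarrow> real" where
  "spread T j j' = (let t = 1 / sqrt T; v = (\<lambda>j. (if j = 0 then 1 else 0) + t)
     in v j * v j' / (1 + t) - (if j = j' then 1 else 0))"

lemma spread_sym: "spread T j j' = spread T j' j"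
  by (simp add: spread_def Let_def)

lemma spread_0:
  assumes "0 < T"
  shows "spread T j 0 = 1 / sqrt T"
proof -
  define t where "t = 1 / sqrt T"
  have "1 + t \<noteq> 0" using assms by (simp add: t_def add_nonneg_eq_0_iff)
  then show ?thesis by (simp add: spread_def Let_def t_def[symmetric])
qed

lemma spread_involution:
  assumes "j < T" "j' < T"
  shows "(\<Sum>k<T. spread T j k * spread T k j') = (if j = j' then 1 else 0)"
proof -
  define t where "t = 1 / sqrt T"
  define v :: "nat \<Rightarrow> real" where "v = (\<lambda>j. (if j = 0 then 1 else 0) + t)"
  have "0 < T" using assms by simp
  have t: "t > 0" "t * t * T = 1" using \<open>0 < T\<close> by (auto simp: t_def)
  have "(\<Sum>k<T. v k * v k) = (\<Sum>k<T. (if k = 0 then 1 + 2 * t else 0) + t * t)"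
    by (intro sum.cong) (auto simp: v_def algebra_simps)
  also have "\<dots> = 2 * (1 + t)"
    using \<open>0 < T\<close> t by (simp add: sum.distrib sum.delta mult.commute mult.left_commute)
  finally have vv: "(\<Sum>k<T. v k * v k) = 2 * (1 + t)" .
  have "(\<Sum>k<T. spread T j k * spread T k j') =
      (\<Sum>k<T. v j * v j' / (1 + t)\<^sup>2 * (v k * v k) - (if k = j then v j * v j' / (1 + t) else 0)
        - (if k = j' then v j * v j' / (1 + t) else 0) + (if k = j then if j = j' then 1 else 0 else 0))"
    by (intro sum.cong)
      (auto simp: spread_def Let_def t_def[symmetric] v_def power2_eq_square algebra_simps)
  also have "\<dots> = v j * v j' / (1 + t)\<^sup>2 * (2 * (1 + t)) - v j * v j' / (1 + t) - v j * v j' / (1 + t)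
      + (if j = j' then 1 else 0)"
    unfolding sum.distrib sum_subtractf sum_distrib_left[symmetric] vv
    using assms by (simp add: sum.delta)
  also have "v j * v j' / (1 + t)\<^sup>2 * (2 * (1 + t)) = v j * v j' / (1 + t) + v j * v j' / (1 + t)"
    using t by (simp add: power2_eq_square field_simps)
  finally show ?thesis by simp
qed

subsection \<open>Averaging a quantum walk\<close>

text \<open>The value at position \<open>idx e\<close> decides by \<open>tst e\<close> whether the
  edge \<open>e\<close> is available. \<open>idx e0 = 0\<close> matches the query index 0 of the
  initial state.\<close>

locale quantum_walk =
  fixes n T :: nat and E :: "'e set" and idx :: "'e \<Rightarrow> nat" and tst :: "'e \<Rightarrow> nat \<Rightarrow> bool"
    and e0 :: 'e and R :: "'e \<Rightarrow> 'e \<Rightarrow> real" and out :: "'e \<Rightarrow> 'o option"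
  assumes T: "0 < T" and fin: "finite E" and e0: "e0 \<in> E" "idx e0 = 0"
    and idx: "e \<in> E \<Longrightarrow> idx e < n" and R: "projection_on E R"
begin

lemma n: "0 < n" using idx[OF e0(1)] by simp

abbreviation "W \<equiv> {..<T} \<times> E"
abbreviation "Q \<equiv> query_basis n 3 W"

definition avail :: "(nat \<Rightarrow> nat) \<Rightarrow> 'e \<Rightarrow> bool" where "avail x e \<longleftrightarrow> tst e (x (idx e))"

text \<open>When \<open>R\<close> projects onto the span of the vertex vectors,
  \<open>1 - 2 R\<close> is the reflection about its orthogonal complement, the circulations; the
  sign is the reflection about the available edges.\<close>

definition walk :: "(nat \<Rightarrow> nat) \<Rightarrow> ('e \<Rightarrow> real) \<Rightarrow> 'e \<Rightarrow> real" where
  "walk x \<phi> e = (if avail x e then 1 else - 1) * (\<phi> e - 2 * (\<Sum>e'\<in>E. R e e' * \<phi> e'))"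

section \<open>Register layout, gates and the algorithm\<close>

definition counter_dec :: "(nat \<times> 'e) qlabel \<Rightarrow> nat \<times> (nat \<times> nat \<times> 'e)" where
  "counter_dec = (\<lambda>(i, z, (j, e)). (j, (i, z, e)))"

definition counter_enc :: "nat \<times> (nat \<times> nat \<times> 'e) \<Rightarrow> (nat \<times> 'e) qlabel" where
  "counter_enc = (\<lambda>(j, (i, z, e)). (i, z, (j, e)))"

text \<open>The index register is read relative to \<open>idx e\<close>. In these coordinates a
  correctly loaded index is 0 for every edge, so a reflection can mix edges with different positions
  and leave each with its own index loaded.\<close>

definition edge_dec :: "(nat \<times> 'e) qlabel \<Rightarrow> 'e \<times> (nat \<times> nat \<times> nat)" where
  "edge_dec = (\<lambda>(i, z, (j, e)). (e, ((i + (n - idx e mod n)) mod n, z, j)))"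

definition edge_enc :: "'e \<times> (nat \<times> nat \<times> nat) \<Rightarrow> (nat \<times> 'e) qlabel" where
  "edge_enc = (\<lambda>(e, (a, z, j)). ((a + idx e) mod n, z, (j, e)))"

sublocale counter: factorization Q "{..<T}" "{..<n} \<times> {..<3} \<times> E" counter_dec counter_enc
  by unfold_locales (use fin in \<open>auto simp: query_basis_def counter_dec_def counter_enc_def\<close>)

sublocale edge: factorization Q E "{..<n} \<times> {..<3} \<times> {..<T}" edge_dec edge_enc
proof
  show "finite E" "finite ({..<n} \<times> {..<3::nat} \<times> {..<T})" using fin by auto
  show "c \<in> Q \<Longrightarrow> edge_dec c \<in> E \<times> {..<n} \<times> {..<3} \<times> {..<T}" for c
    using n by (auto simp: query_basis_def edge_dec_def)
  show "p \<in> E \<times> {..<n} \<times> {..<3} \<times> {..<T} \<Longrightarrow> edge_enc p \<in> Q" for p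
    using n by (auto simp: query_basis_def edge_enc_def)
  show "edge_enc (edge_dec c) = c" if "c \<in> Q" for c
  proof -
    obtain i z j e where c: "c = (i, z, (j, e))" "i < n" using \<open>c \<in> Q\<close> by (auto simp: query_basis_def)
    have "i = ((i + (n - idx e mod n)) mod n + idx e) mod n"
      using c n by (subst eq_add_mod_iff) auto
    then show ?thesis by (simp add: c edge_dec_def edge_enc_def del: Nat.add_diff_assoc)
  qed
  show "edge_dec (edge_enc p) = p" if "p \<in> E \<times> {..<n} \<times> {..<3} \<times> {..<T}" for p
  proof -
    obtain e a z j where p: "p = (e, (a, z, j))" "a < n"
      using \<open>p \<in> E \<times> {..<n} \<times> {..<3} \<times> {..<T}\<close> by auto
    have "a = ((a + idx e) mod n + (n - idx e mod n)) mod n"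
      using p n by (subst eq_add_mod_iff[symmetric]) auto
    then show ?thesis by (simp add: p edge_dec_def edge_enc_def del: Nat.add_diff_assoc)
  qed
qed

definition emb :: "(nat \<Rightarrow> 'e \<Rightarrow> real) \<Rightarrow> (nat \<times> 'e) qlabel qstate" where
  "emb \<Phi> = (\<lambda>(i, z, (j, e)). if i = idx e \<and> z = 0 then complex_of_real (\<Phi> j e) else 0)"

definition spread_gate :: "(nat \<times> 'e) qlabel qoperator" where
  "spread_gate = block_op counter_dec (\<lambda>_ j j'. complex_of_real (spread T j j'))"

text \<open>Round \<open>k\<close> acts only on counters \<open>j \<ge> k\<close>, so counter
  \<open>j\<close> sees exactly \<open>j\<close> rounds; elsewhere the reflection for the zero
  matrix is the identity. The queries are not controlled: without a phase between them the three of
  a round cancel.\<close>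

definition reflect_gate :: "nat \<Rightarrow> (nat \<times> 'e) qlabel qoperator" where
  "reflect_gate k = block_op edge_dec
     (\<lambda>(a, z, j). reflection (if a = 0 \<and> z = 0 \<and> k \<le> j then R else (\<lambda>_ _. 0)))"

definition phase :: "nat \<Rightarrow> (nat \<times> 'e) qlabel \<Rightarrow> complex" where
  "phase k = (\<lambda>(i, z, (j, e)). if k \<le> j \<and> \<not> tst e z then - 1 else 1)"

definition phase_gate :: "nat \<Rightarrow> (nat \<times> 'e) qlabel qoperator" where
  "phase_gate k c c' = (if c = c' then phase k c else 0)"

text \<open>Since values are added modulo 3, the last two queries undo the first one.\<close>

definition walk_steps :: "nat \<Rightarrow> (nat \<times> 'e) qstep list" where
  "walk_steps k = [Gate (reflect_gate k), Query, Gate (phase_gate k), Query, Query]"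

definition algorithm :: "(nat \<times> 'e, 'o option) qalgorithm" where
  "algorithm = \<lparr> qa_work = W, qa_start = (0, e0),
     qa_steps = Gate spread_gate # concat (map walk_steps [1..<T]) @ [Gate spread_gate],
     qa_output = (\<lambda>(i, z, (j, e)). if j = 0 then out e else None) \<rparr>"

lemma finite_Q: "finite Q"
  by (rule edge.finite_C)

lemma unitary_gates:
  "unitary_on Q spread_gate" "unitary_on Q (reflect_gate k)" "unitary_on Q (phase_gate k)"
proof -
  show "unitary_on Q spread_gate"
    unfolding spread_gate_def
  proof (rule counter.unitary_block_op)
    show "unitary_on {..<T} (\<lambda>j j'. complex_of_real (spread T j j'))"
    proof (rule unitary_onI_involution)
      fix j j' assume "j \<in> {..<T}" "j' \<in> {..<T}"
      then show "(\<Sum>k\<in>{..<T}. complex_of_real (spread T j k) * complex_of_real (spread T k j')) =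
          (if j = j' then 1 else 0)"
        unfolding of_real_mult[symmetric] of_real_sum[symmetric] using spread_involution by simp
    qed (simp_all add: spread_sym)
  qed
  show "unitary_on Q (reflect_gate k)"
    unfolding reflect_gate_def
  proof (rule edge.unitary_block_op)
    have "projection_on E (\<lambda>_ _. 0)" by (simp add: projection_on_def)
    then show "unitary_on E ((\<lambda>(a, z, j). reflection (if a = 0 \<and> z = 0 \<and> k \<le> j then R else (\<lambda>_ _. 0))) s)"
      for s
      using R fin by (cases s) (auto intro!: unitary_on_reflection)
  qed
  show "unitary_on Q (phase_gate k)"
  proof (rule unitary_onI_involution[OF finite_Q])
    fix b b' assume b: "b \<in> Q" "b' \<in> Q"
    show "cnj (phase_gate k b b') = phase_gate k b' b"
      by (auto simp: phase_gate_def phase_def split: prod.splits)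
    have "(\<Sum>c\<in>Q. phase_gate k b c * phase_gate k c b') = (\<Sum>c\<in>Q. if c = b then if b = b' then 1 else 0 else 0)"
      by (intro sum.cong) (auto simp: phase_gate_def phase_def split: prod.splits)
    then show "(\<Sum>c\<in>Q. phase_gate k b c * phase_gate k c b') = (if b = b' then 1 else 0)"
      using b finite_Q by simp
  qed
qed

lemma query_algorithm: "query_algorithm n 3 algorithm"
  using unitary_gates n fin T e0
  by (auto simp: query_algorithm_def valid_circuit_def algorithm_def walk_steps_def)

lemma query_count_algorithm: "query_count (qa_steps algorithm) = 3 * (T - 1)"
proof -
  have "count_list (concat (map walk_steps ks)) Query = 3 * length ks" for ks
    by (induction ks) (auto simp: walk_steps_def)
  then show ?thesis by (simp add: query_count_def algorithm_def)
qed

section \<open>Action of the gates on loaded states\<close>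

lemma apply_spread_gate:
  assumes "c \<in> Q"
  shows "apply_op Q spread_gate (emb \<Phi>) c = emb (\<lambda>j e. \<Sum>j'<T. spread T j j' * \<Phi> j' e) c"
proof -
  obtain i z j e where c: "c = (i, z, (j, e))" "i < n" "z < 3" "j < T" "e \<in> E"
    using assms by (auto simp: query_basis_def)
  have "apply_op Q spread_gate (emb \<Phi>) c = apply_op Q spread_gate (emb \<Phi>) (counter_enc (j, (i, z, e)))"
    by (simp add: c counter_enc_def)
  also have "\<dots> =
      apply_op {..<T} (\<lambda>j j'. complex_of_real (spread T j j')) (\<lambda>j'. emb \<Phi> (counter_enc (j', (i, z, e)))) j"
    unfolding spread_gate_def using c by (intro counter.apply_block_op) auto
  also have "\<dots> = emb (\<lambda>j e. \<Sum>j'<T. spread T j j' * \<Phi> j' e) c"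
    by (cases "i = idx e \<and> z = 0") (auto simp: c counter_enc_def apply_op_def emb_def)
  finally show ?thesis .
qed

lemma apply_reflect_gate:
  assumes "c \<in> Q"
  shows "apply_op Q (reflect_gate k) (emb \<Phi>) c =
    emb (\<lambda>j e. if k \<le> j then \<Phi> j e - 2 * (\<Sum>e'\<in>E. R e e' * \<Phi> j e') else \<Phi> j e) c"
proof -
  obtain e a z j where p: "edge_dec c = (e, (a, z, j))" "e \<in> E" "a < n" "z < 3" "j < T"
    using edge.dec_in[OF assms] by (cases "edge_dec c") auto
  then have c: "c = edge_enc (e, (a, z, j))" using edge.enc_dec[OF assms] by simp
  have idx_eq: "(a + idx e') mod n = idx e' \<longleftrightarrow> a = 0" if "e' \<in> E" for e'
  proof -
    have "idx e' = (a + idx e') mod n \<longleftrightarrow> a = (idx e' + (n - idx e' mod n)) mod n"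
      using idx[OF that] p by (intro eq_add_mod_iff) auto
    moreover have "idx e' + (n - idx e' mod n) = n" using idx[OF that] by simp
    ultimately show ?thesis by auto
  qed
  let ?M = "if a = 0 \<and> z = 0 \<and> k \<le> j then R else (\<lambda>_ _. 0)"
  have "apply_op Q (reflect_gate k) (emb \<Phi>) c =
      apply_op E (reflection ?M) (\<lambda>e'. emb \<Phi> (edge_enc (e', (a, z, j)))) e"
    unfolding c reflect_gate_def using p by (subst edge.apply_block_op) auto
  also have "\<dots> = apply_op E (reflection ?M)
      (\<lambda>e'. complex_of_real (if a = 0 \<and> z = 0 then \<Phi> j e' else 0)) e"
    by (subst apply_op_cong[where \<phi> = "\<lambda>e'. complex_of_real (if a = 0 \<and> z = 0 then \<Phi> j e' else 0)"])
      (auto simp: emb_def edge_enc_def idx_eq)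
  also have "\<dots> = emb (\<lambda>j e. if k \<le> j then \<Phi> j e - 2 * (\<Sum>e'\<in>E. R e e' * \<Phi> j e') else \<Phi> j e) c"
    using p fin by (subst apply_reflection) (auto simp: c emb_def edge_enc_def idx_eq)
  finally show ?thesis .
qed

lemma three_queries:
  fixes b z :: nat
  assumes "z < 3" "b < 3"
  shows "(((z + (3 - b)) mod 3 + (3 - b)) mod 3 + (3 - b)) mod 3 = z"
    "((0 + (3 - b)) mod 3 + (3 - b)) mod 3 = b"
proof -
  have "z = 0 \<or> z = 1 \<or> z = 2" "b = 0 \<or> b = 1 \<or> b = 2" using assms by linarith+
  then show "(((z + (3 - b)) mod 3 + (3 - b)) mod 3 + (3 - b)) mod 3 = z"
    "((0 + (3 - b)) mod 3 + (3 - b)) mod 3 = b"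
    by (elim disjE; simp)+
qed

lemma apply_phase_queries:
  assumes c: "c \<in> Q" and x: "x \<in> query_inputs n 3"
  shows "run_circuit n 3 W x [Query, Gate (phase_gate k), Query, Query] (emb \<Phi>) c =
    emb (\<lambda>j e. if k \<le> j \<and> \<not> avail x e then - \<Phi> j e else \<Phi> j e) c"
proof -
  obtain i z j e where c': "c = (i, z, (j, e))" "i < n" "z < 3" "j < T" "e \<in> E"
    using c by (auto simp: query_basis_def)
  define s where "s z = (z + (3 - x i mod 3)) mod 3" for z
  have s: "s z < 3" for z by (simp add: s_def)
  have xi: "x i < 3" using x c'(2) by (auto simp: query_inputs_def)
  have xi': "x i mod 3 = x i" using xi by simp
  have ss: "s (s (s z)) = z" "s (s 0) = x i"
    unfolding s_def xi' by (rule three_queries[OF c'(3) xi])+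
  have query: "apply_op Q (query_op 3 x) \<psi> (i, z', (j, e)) = \<psi> (i, s z', (j, e))" if "z' < 3" for \<psi> z'
    unfolding s_def using that c' fin by (intro apply_query_op) auto
  have inQ: "(i, z', (j, e)) \<in> Q" if "z' < 3" for z'
    using that c' by (simp add: query_basis_def)
  have phase: "apply_op Q (phase_gate k) \<psi> c' = phase k c' * \<psi> c'" if "c' \<in> Q" for \<psi> c'
  proof -
    have "apply_op Q (phase_gate k) \<psi> c' = (\<Sum>b\<in>Q. if b = c' then phase k c' * \<psi> c' else 0)"
      unfolding apply_op_def phase_gate_def by (intro sum.cong) auto
    then show ?thesis using that finite_Q by simp
  qed
  have "run_circuit n 3 W x [Query, Gate (phase_gate k), Query, Query] (emb \<Phi>) c =
      phase k (i, s (s z), (j, e)) * emb \<Phi> (i, s (s (s z)), (j, e))"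
    by (simp only: run_circuit_Cons run_circuit_Nil step_op.simps c'(1) query phase inQ s c'(3))
  also have "\<dots> = emb (\<lambda>j e. if k \<le> j \<and> \<not> avail x e then - \<Phi> j e else \<Phi> j e) c"
    unfolding ss(1) by (cases "i = idx e \<and> z = 0") (auto simp: c' emb_def phase_def avail_def ss(2))
  finally show ?thesis .
qed

lemma run_walk_steps:
  assumes c: "c \<in> Q" and x: "x \<in> query_inputs n 3"
  shows "run_circuit n 3 W x (walk_steps k) (emb \<Phi>) c =
    emb (\<lambda>j e. if k \<le> j then walk x (\<Phi> j) e else \<Phi> j e) c"
proof -
  let ?\<Phi> = "\<lambda>j e. if k \<le> j then \<Phi> j e - 2 * (\<Sum>e'\<in>E. R e e' * \<Phi> j e') else \<Phi> j e"
  have "run_circuit n 3 W x (walk_steps k) (emb \<Phi>) c =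
      run_circuit n 3 W x [Query, Gate (phase_gate k), Query, Query]
        (apply_op Q (reflect_gate k) (emb \<Phi>)) c"
    unfolding walk_steps_def by (subst run_circuit_Cons) simp
  also have "\<dots> = run_circuit n 3 W x [Query, Gate (phase_gate k), Query, Query] (emb ?\<Phi>) c"
    by (intro run_circuit_cong apply_reflect_gate c)
  also have "\<dots> = emb (\<lambda>j e. if k \<le> j then walk x (\<Phi> j) e else \<Phi> j e) c"
    unfolding apply_phase_queries[OF c x]
    by (auto simp: emb_def walk_def split: prod.splits)
  finally show ?thesis .
qed

section \<open>The averaged amplitude and the output distribution\<close>

definition average :: "(nat \<Rightarrow> nat) \<Rightarrow> 'e \<Rightarrow> real" where
  "average x e = (\<Sum>j<T. (walk x ^^ j) (\<lambda>e. if e = e0 then 1 else 0) e) / T"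

text \<open>The uniform counter contributes one factor \<open>1 / sqrt T\<close> and its overlap in
  the second \<open>spread\<close> another. Components at other counter values always answer
  \<open>None\<close>, so they need no formula.\<close>

lemma final_state_algorithm:
  assumes c: "(i, z, (0, e)) \<in> Q" and x: "x \<in> query_inputs n 3"
  shows "final_state n 3 algorithm x (i, z, (0, e)) = (if i = idx e \<and> z = 0 then average x e else 0)"
proof -
  define \<delta> :: "'e \<Rightarrow> real" where "\<delta> = (\<lambda>e. if e = e0 then 1 else 0)"
  have walk_scale: "walk x (\<lambda>e. a * \<phi> e) = (\<lambda>e. a * walk x \<phi> e)" for a \<phi>
    by (auto simp: walk_def algebra_simps sum_distrib_left)
  \<comment> \<open>After \<open>k\<close> rounds the branch of counter \<open>j\<close> has walked
    \<open>min j k\<close> times, as it joins the rounds up to \<open>j\<close> only.\<close>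
  have rounds: "run_circuit n 3 W x (concat (map walk_steps [1..<Suc k]))
      (emb (\<lambda>j e. 1 / sqrt T * \<delta> e)) c = emb (\<lambda>j e. 1 / sqrt T * (walk x ^^ min j k) \<delta> e) c"
    if "c \<in> Q" for c k
    using that
  proof (induction k arbitrary: c)
    case (Suc k)
    have "run_circuit n 3 W x (concat (map walk_steps [1..<Suc (Suc k)])) (emb (\<lambda>j e. 1 / sqrt T * \<delta> e)) c =
        run_circuit n 3 W x (walk_steps (Suc k))
          (run_circuit n 3 W x (concat (map walk_steps [1..<Suc k])) (emb (\<lambda>j e. 1 / sqrt T * \<delta> e))) c"
      by simp
    also have "\<dots> = run_circuit n 3 W x (walk_steps (Suc k))
          (emb (\<lambda>j e. 1 / sqrt T * (walk x ^^ min j k) \<delta> e)) c"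
      by (intro run_circuit_cong Suc)
    also have "\<dots> = emb (\<lambda>j e. 1 / sqrt T * (walk x ^^ min j (Suc k)) \<delta> e) c"
    proof -
      have "(if Suc k \<le> j then walk x (\<lambda>e. 1 / sqrt T * (walk x ^^ min j k) \<delta> e) e
            else 1 / sqrt T * (walk x ^^ min j k) \<delta> e) = 1 / sqrt T * (walk x ^^ min j (Suc k)) \<delta> e" for j e
        unfolding walk_scale by (auto simp: min_def not_less_eq_eq)
      then show ?thesis unfolding run_walk_steps[OF Suc.prems x] by simp
    qed
    finally show ?case .
  qed simp
  have "final_state n 3 algorithm x (i, z, (0, e)) =
      apply_op Q spread_gate (run_circuit n 3 W x (concat (map walk_steps [1..<T]))
        (apply_op Q spread_gate (emb (\<lambda>j e. if j = 0 then \<delta> e else 0)))) (i, z, (0, e))"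
  proof -
    have "ket (0, 0, (0, e0)) = emb (\<lambda>j e. if j = 0 then \<delta> e else 0)"
      using e0 by (auto simp: ket_def emb_def \<delta>_def)
    then show ?thesis by (simp add: final_state_def algorithm_def)
  qed
  also have "\<dots> = apply_op Q spread_gate (run_circuit n 3 W x (concat (map walk_steps [1..<T]))
        (emb (\<lambda>j e. 1 / sqrt T * \<delta> e))) (i, z, (0, e))"
  proof -
    have "apply_op Q spread_gate (emb (\<lambda>j e. if j = 0 then \<delta> e else 0)) b = emb (\<lambda>j e. 1 / sqrt T * \<delta> e) b"
      if "b \<in> Q" for b
      unfolding apply_spread_gate[OF that]
      by (auto simp: emb_def if_distrib sum.delta spread_0 T cong: if_cong split: prod.splits)
    then have "apply_op Q spread_gate (run_circuit n 3 W x (concat (map walk_steps [1..<T]))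
        (apply_op Q spread_gate (emb (\<lambda>j e. if j = 0 then \<delta> e else 0)))) =
      apply_op Q spread_gate (run_circuit n 3 W x (concat (map walk_steps [1..<T]))
        (emb (\<lambda>j e. 1 / sqrt T * \<delta> e)))"
      by (intro apply_op_cong run_circuit_cong)
    then show ?thesis by (rule fun_cong)
  qed
  also have "\<dots> = apply_op Q spread_gate (emb (\<lambda>j e. 1 / sqrt T * (walk x ^^ min j (T - 1)) \<delta> e)) (i, z, (0, e))"
  proof -
    have "Suc (T - 1) = T" using T by simp
    then have "apply_op Q spread_gate (run_circuit n 3 W x (concat (map walk_steps [1..<T]))
        (emb (\<lambda>j e. 1 / sqrt T * \<delta> e))) =
      apply_op Q spread_gate (emb (\<lambda>j e. 1 / sqrt T * (walk x ^^ min j (T - 1)) \<delta> e))"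
      using rounds[of _ "T - 1"] by (intro apply_op_cong) (simp only:)
    then show ?thesis by (rule fun_cong)
  qed
  also have "\<dots> = (if i = idx e \<and> z = 0 then average x e else 0)"
  proof -
    have "(\<Sum>j'<T. spread T 0 j' * (1 / sqrt T * (walk x ^^ min j' (T - 1)) \<delta> e)) =
        (\<Sum>j<T. (walk x ^^ j) \<delta> e / T)"
    proof (intro sum.cong refl)
      fix j assume "j \<in> {..<T}"
      then have "min j (T - 1) = j" by auto
      then show "spread T 0 j * (1 / sqrt T * (walk x ^^ min j (T - 1)) \<delta> e) = (walk x ^^ j) \<delta> e / T"
        using T by (simp add: spread_sym[of T 0] spread_0)
    qed
    then show ?thesis
      unfolding apply_spread_gate[OF c] by (simp add: emb_def average_def sum_divide_distrib \<delta>_def)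
  qed
  finally show ?thesis .
qed

lemma output_prob_algorithm:
  assumes x: "x \<in> query_inputs n 3"
  shows "output_prob n 3 algorithm x (\<lambda>a. a \<noteq> None \<and> P a) =
    (\<Sum>e\<in>E. if out e \<noteq> None \<and> P (out e) then (average x e)\<^sup>2 else 0)"
proof -
  let ?F = "\<lambda>b. if qa_output algorithm b \<noteq> None \<and> P (qa_output algorithm b)
    then (cmod (final_state n 3 algorithm x b))\<^sup>2 else 0"
  have work: "qa_work algorithm = W" by (simp add: algorithm_def)
  have "output_prob n 3 algorithm x (\<lambda>a. a \<noteq> None \<and> P a) = (\<Sum>b\<in>Q. ?F b)"
    using fin by (subst output_prob_alt) (auto simp: work)
  also have "\<dots> = (\<Sum>e\<in>E. \<Sum>s\<in>{..<n} \<times> {..<3::nat} \<times> {..<T}.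
      if s = (0, 0, 0) then if out e \<noteq> None \<and> P (out e) then (average x e)\<^sup>2 else 0 else 0)"
    unfolding edge.sum_factorization
  proof (intro sum.cong refl, goal_cases)
    case (1 e s)
    then have e: "e \<in> E" by simp
    from 1 obtain a z j where s: "s = (a, z, j)" "a < n" "z < 3" "j < T" by auto
    have "idx e = (a + idx e) mod n \<longleftrightarrow> a = (idx e + (n - idx e mod n)) mod n"
      using idx[OF e] s by (intro eq_add_mod_iff) auto
    then have a: "(a + idx e) mod n = idx e \<longleftrightarrow> a = 0" using idx[OF e] by auto
    show ?case
    proof (cases "j = 0")
      case True
      have "((a + idx e) mod n, z, (0, e)) \<in> Q" using s e n T by (auto simp: query_basis_def)
      from final_state_algorithm[OF this x] True show ?thesis
        by (auto simp: s edge_enc_def a algorithm_def)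
    next
      case False
      then show ?thesis by (simp add: s edge_enc_def algorithm_def)
    qed
  qed
  also have "\<dots> = (\<Sum>e\<in>E. if out e \<noteq> None \<and> P (out e) then (average x e)\<^sup>2 else 0)"
    using n T by (intro sum.cong refl) (simp add: sum.delta)
  finally show ?thesis .
qed

section \<open>Norm preservation and the error of the average\<close>

lemma walk_cong: "(\<And>e. e \<in> E \<Longrightarrow> \<phi> e = \<psi> e) \<Longrightarrow> e \<in> E \<Longrightarrow> walk x \<phi> e = walk x \<psi> e"
  unfolding walk_def by (auto intro!: sum.cong)

lemma walk_linear:
  "walk x (\<lambda>e. g e + (a e - b e) / 2) e = walk x g e + (walk x a e - walk x b e) / 2"
proof -
  have "(\<Sum>e'\<in>E. R e e' * (g e' + (a e' - b e') / 2)) =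
      (\<Sum>e'\<in>E. R e e' * g e') + ((\<Sum>e'\<in>E. R e e' * a e') - (\<Sum>e'\<in>E. R e e' * b e')) / 2"
    by (simp add: sum.distrib sum_subtractf sum_divide_distrib diff_divide_distrib algebra_simps)
  then show ?thesis by (simp add: walk_def field_simps)
qed

text \<open>The signs disappear under the square, and symmetry with idempotence gives equal squared
  norm of \<open>R \<phi>\<close> and inner product of \<open>\<phi>\<close> with
  \<open>R \<phi>\<close>, so the cross terms cancel.\<close>

lemma walk_norm: "(\<Sum>e\<in>E. (walk x \<phi> e)\<^sup>2) = (\<Sum>e\<in>E. (\<phi> e)\<^sup>2)"
proof -
  let ?p = "\<lambda>e. \<Sum>e'\<in>E. R e e' * \<phi> e'"
  have "(\<Sum>e\<in>E. ?p e * ?p e) = (\<Sum>e\<in>E. \<phi> e * (\<Sum>e'\<in>E. R e e' * ?p e'))"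
    using R by (intro sum_symmetric_matrix) (auto simp: projection_on_def)
  also have "\<dots> = (\<Sum>e\<in>E. \<phi> e * ?p e)"
    using projection_on_idem[OF R] by simp
  finally have *: "(\<Sum>e\<in>E. ?p e * ?p e) = (\<Sum>e\<in>E. \<phi> e * ?p e)" .
  have "(\<Sum>e\<in>E. (walk x \<phi> e)\<^sup>2) = (\<Sum>e\<in>E. (\<phi> e)\<^sup>2 + 4 * (?p e * ?p e) - 4 * (\<phi> e * ?p e))"
    by (intro sum.cong) (auto simp: walk_def power2_eq_square algebra_simps)
  then show ?thesis
    by (simp add: sum.distrib sum_subtractf sum_distrib_left[symmetric] *)
qed

lemma walk_pow_norm: "(\<Sum>e\<in>E. ((walk x ^^ j) \<phi> e)\<^sup>2) = (\<Sum>e\<in>E. (\<phi> e)\<^sup>2)"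
  by (induction j) (simp_all add: walk_norm)

text \<open>Effective spectral gap: \<open>g\<close> is fixed by the walk, and the rest of the initial state is
  \<open>(w - walk w) / 2\<close>, so that its contribution to the average telescopes.\<close>

lemma average_error:
  assumes w: "\<And>e. e \<in> E \<Longrightarrow> (\<Sum>e'\<in>E. R e e' * w e') = w e"
    and g: "\<And>e. e \<in> E \<Longrightarrow> (\<Sum>e'\<in>E. R e e' * g e') = 0"
    and g_avail: "\<And>e. e \<in> E \<Longrightarrow> \<not> avail x e \<Longrightarrow> g e = 0"
    and start: "\<And>e. e \<in> E \<Longrightarrow> (if e = e0 then 1 else 0) = g e + (if avail x e then w e else 0)"
  shows "(\<Sum>e\<in>E. (average x e - g e)\<^sup>2) \<le> (\<Sum>e\<in>E. (w e)\<^sup>2) / T\<^sup>2"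
proof -
  define \<delta> :: "'e \<Rightarrow> real" where "\<delta> = (\<lambda>e. if e = e0 then 1 else 0)"
  have step: "(walk x ^^ j) \<delta> e = g e + ((walk x ^^ j) w e - (walk x ^^ Suc j) w e) / 2" if "e \<in> E" for j e
    using that
  proof (induction j arbitrary: e)
    case 0
    \<comment> \<open>The walk negates \<open>w\<close> on available edges and keeps it elsewhere,
      so \<open>(w - walk w) / 2\<close> is \<open>w\<close> cut down to the available
      edges.\<close>
    have "walk x w e = (if avail x e then - w e else w e)"
      using w[OF 0] by (simp add: walk_def)
    then show ?case using start[OF 0] by (auto simp: \<delta>_def)
  next
    case (Suc j)
    let ?a = "(walk x ^^ j) w" and ?b = "(walk x ^^ Suc j) w"
    have "(walk x ^^ Suc j) \<delta> e = walk x (\<lambda>e. g e + (?a e - ?b e) / 2) e"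
      using Suc by (simp only: funpow.simps o_apply) (intro walk_cong, auto)
    also have "\<dots> = walk x g e + (walk x ?a e - walk x ?b e) / 2"
      by (rule walk_linear)
    also have "walk x g e = g e"
      using g[OF Suc.prems] g_avail[OF Suc.prems] by (simp add: walk_def)
    finally show ?case by simp
  qed
  have avg: "average x e - g e = (w e - (walk x ^^ T) w e) / (2 * T)" if "e \<in> E" for e
  proof -
    have "(\<Sum>j<T. (walk x ^^ j) \<delta> e) = T * g e + (\<Sum>j<T. (walk x ^^ j) w e - (walk x ^^ Suc j) w e) / 2"
      unfolding sum_divide_distrib by (simp add: step[OF that] sum.distrib)
    also have "(\<Sum>j<T. (walk x ^^ j) w e - (walk x ^^ Suc j) w e) = w e - (walk x ^^ T) w e"
      by (subst sum_lessThan_telescope') simp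
    finally show ?thesis
      unfolding average_def \<delta>_def[symmetric] using T by (simp only:) (simp add: field_simps)
  qed
  have "(\<Sum>e\<in>E. (average x e - g e)\<^sup>2) = (\<Sum>e\<in>E. (w e - (walk x ^^ T) w e)\<^sup>2) / (4 * T\<^sup>2)"
    unfolding sum_divide_distrib using avg by (intro sum.cong) (auto simp: power_divide power_mult_distrib)
  \<comment> \<open>Both terms have the norm of \<open>w\<close>, so the resulting factor 4 cancels
    the one from \<open>(2 * T)^2\<close>.\<close>
  also have "(\<Sum>e\<in>E. (w e - (walk x ^^ T) w e)\<^sup>2) \<le> (\<Sum>e\<in>E. 2 * (w e)\<^sup>2 + 2 * ((walk x ^^ T) w e)\<^sup>2)"
  proof (intro sum_mono)
    fix e
    have "0 \<le> (w e + (walk x ^^ T) w e)\<^sup>2" by simp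
    then show "(w e - (walk x ^^ T) w e)\<^sup>2 \<le> 2 * (w e)\<^sup>2 + 2 * ((walk x ^^ T) w e)\<^sup>2"
      by (simp add: power2_eq_square algebra_simps)
  qed
  also have "\<dots> = 4 * (\<Sum>e\<in>E. (w e)\<^sup>2)"
    by (simp add: sum.distrib sum_distrib_left[symmetric] walk_pow_norm)
  finally show ?thesis using T by (simp add: divide_right_mono field_simps)
qed

end

subsection \<open>The electrical network\<close>

text \<open>\<open>Loop\<close> joins the grounded target to the source.  The vertex \<open>(l, i)\<close> means that \<open>l\<close> carries
  a 2 and that zeros were read strictly between \<open>l\<close> and \<open>i\<close>; \<open>First l\<close> leads from the source to
  \<open>(l, l + 1)\<close>, \<open>Mid l i\<close> from \<open>(l, i)\<close> to \<open>(l, i + 1)\<close>, and \<open>Last l i\<close> from \<open>(l, i)\<close> to the target.\<close>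

datatype edge = Loop | First nat | Mid nat nat | Last nat nat

instance edge :: countable
  by countable_datatype

definition edges :: "nat \<Rightarrow> edge set" where
  "edges n = {Loop} \<union> First ` {..<n} \<union> (\<lambda>(l, i). Mid l i) ` (SIGMA l:{..<n}. {l<..<n})
     \<union> (\<lambda>(l, i). Last l i) ` (SIGMA l:{..<n}. {l<..<n})"

fun position :: "edge \<Rightarrow> nat" where
  "position Loop = 0"
| "position (First l) = l"
| "position (Mid l i) = i"
| "position (Last l i) = i"

fun test :: "edge \<Rightarrow> nat \<Rightarrow> bool" where
  "test Loop z \<longleftrightarrow> True"
| "test (First l) z \<longleftrightarrow> z = 2"
| "test (Mid l i) z \<longleftrightarrow> z = 0"
| "test (Last l i) z \<longleftrightarrow> z = 2"

fun answer :: "edge \<Rightarrow> (nat \<times> nat) option" where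
  "answer (Last l r) = Some (l, r)"
| "answer _ = None"

definition harmonic :: "nat \<Rightarrow> real" where
  "harmonic n = (\<Sum>k=1..n. 1 / real k)"

text \<open>These conductances keep the resistance of a run of zeros bounded, while cutting the line of
  \<open>l\<close> at its first nonzero value costs only the length of the run, up to the harmonic factor; the
  runs are disjoint, so all cuts together cost at most \<open>n * harmonic n\<close>.\<close>

definition weight :: "nat \<Rightarrow> nat \<Rightarrow> real" where
  "weight n k = real k * harmonic n"

definition resistance :: "nat \<Rightarrow> nat \<Rightarrow> real" where
  "resistance n m = (\<Sum>k\<in>{1..<m}. 1 / weight n k)"

text \<open>This and \<open>vertex_vec\<close> are rows of the incidence matrix with each edge
  scaled by the square root of its conductance. If \<open>g\<close> is a current divided by these
  roots, orthogonality to the rows is Kirchhoff's current law and the squared norm of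
  \<open>g\<close> is the dissipated energy.\<close>

fun source_vec :: "real \<Rightarrow> edge \<Rightarrow> real" where
  "source_vec c Loop = sqrt c"
| "source_vec c (First l) = 1"
| "source_vec c _ = 0"

fun vertex_vec :: "nat \<Rightarrow> nat \<Rightarrow> nat \<Rightarrow> edge \<Rightarrow> real" where
  "vertex_vec n l i Loop = 0"
| "vertex_vec n l i (First l') = (if l' = l then if i = Suc l then - 1 else 0 else 0)"
| "vertex_vec n l i (Mid l' k) =
     (if l' = l then (if k = i then sqrt (weight n (k - l)) else 0)
        - (if Suc k = i then sqrt (weight n (k - l)) else 0) else 0)"
| "vertex_vec n l i (Last l' k) = (if l' = l then if k = i then 1 else 0 else 0)"

text \<open>The grounded target gets no vector. The range includes \<open>(l, n)\<close>, the dead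
  end of a run of zeros that lasts to the end of the string; orthogonality there keeps current out
  of it.\<close>

definition vertex_vecs :: "nat \<Rightarrow> real \<Rightarrow> (edge \<Rightarrow> real) set" where
  "vertex_vecs n c =
     insert (source_vec c) ((\<lambda>(l, i). vertex_vec n l i) ` (SIGMA l:{..<n}. {l<..n}))"

section \<open>Sums over edges and bounds on resistances\<close>

lemma finite_edges: "finite (edges n)"
  by (auto simp: edges_def)

lemma finite_vertex_vecs: "finite (vertex_vecs n c)"
  by (auto simp: vertex_vecs_def)

lemma position_less: "0 < n \<Longrightarrow> e \<in> edges n \<Longrightarrow> position e < n"
  by (auto simp: edges_def)

lemma sum_edges:
  fixes F :: "edge \<Rightarrow> real"
  shows "(\<Sum>e\<in>edges n. F e) = F Loop + (\<Sum>l<n. F (First l)) +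
    (\<Sum>l<n. \<Sum>i\<in>{l<..<n}. F (Mid l i)) + (\<Sum>l<n. \<Sum>i\<in>{l<..<n}. F (Last l i))"
proof -
  let ?P = "SIGMA l:{..<n}. {l<..<n}"
  have union: "sum F ({Loop} \<union> A \<union> B \<union> C) = F Loop + sum F A + sum F B + sum F C"
    if "finite A" "finite B" "finite C" "Loop \<notin> A \<union> B \<union> C" "A \<inter> B = {}" "(A \<union> B) \<inter> C = {}" for A B C
    using that by (simp add: sum.union_disjoint)
  have inj: "inj_on First {..<n}" "inj_on (\<lambda>(l, i). Mid l i) ?P" "inj_on (\<lambda>(l, i). Last l i) ?P"
    by (auto simp: inj_on_def)
  have "(\<Sum>e\<in>edges n. F e) = F Loop + sum F (First ` {..<n}) + sum F ((\<lambda>(l, i). Mid l i) ` ?P)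
      + sum F ((\<lambda>(l, i). Last l i) ` ?P)"
    unfolding edges_def by (rule union) auto
  also have "\<dots> = F Loop + (\<Sum>l<n. F (First l)) + (\<Sum>(l, i)\<in>?P. F (Mid l i)) + (\<Sum>(l, i)\<in>?P. F (Last l i))"
    unfolding sum.reindex[OF inj(1)] sum.reindex[OF inj(2)] sum.reindex[OF inj(3)]
    by (simp add: case_prod_beta comp_def)
  finally show ?thesis by (simp add: sum.Sigma)
qed

lemma harmonic_ge_1: "0 < n \<Longrightarrow> 1 \<le> harmonic n"
  unfolding harmonic_def
  using member_le_sum[of 1 "{1..n}" "\<lambda>k. 1 / real k"] by auto

lemma harmonic_le: "0 < n \<Longrightarrow> harmonic n \<le> 1 + ln (real n)"
proof (induction n)
  case (Suc n)
  show ?case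
  proof (cases "n = 0")
    case False
    have "ln (real n / real (Suc n)) \<le> real n / real (Suc n) - 1"
      using False by (intro ln_le_minus_one) simp
    also have "\<dots> = - 1 / real (Suc n)" by (simp add: field_simps)
    finally have "1 / real (Suc n) \<le> ln (real (Suc n)) - ln (real n)"
      using False by (simp add: ln_div)
    then show ?thesis using Suc False by (simp add: harmonic_def)
  qed (simp add: harmonic_def)
qed simp

context
  fixes n :: nat
  assumes n: "0 < n"
begin

lemma weight_ge: "1 \<le> k \<Longrightarrow> 1 \<le> weight n k"
proof -
  assume "1 \<le> k"
  then have "1 * 1 \<le> real k * harmonic n"
    using harmonic_ge_1[OF n] by (intro mult_mono) auto
  then show ?thesis by (simp add: weight_def)
qed

lemma resistance_nonneg: "0 \<le> resistance n m"
  unfolding resistance_def using weight_ge by (intro sum_nonneg) (auto intro: order_trans[OF zero_le_one])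

lemma resistance_mono: "m \<le> m' \<Longrightarrow> resistance n m \<le> resistance n m'"
  unfolding resistance_def using weight_ge
  by (intro sum_mono2) (auto intro: order_trans[OF zero_le_one])

lemma resistance_1: "resistance n (Suc 0) = 0"
  by (simp add: resistance_def)

lemma resistance_Suc: "1 \<le> m \<Longrightarrow> resistance n (Suc m) = resistance n m + 1 / weight n m"
  by (simp add: resistance_def)

text \<open>The factor \<open>harmonic n\<close> in \<open>weight\<close> is made for this
  normalization.\<close>

lemma resistance_le_1: "m \<le> n \<Longrightarrow> resistance n m \<le> 1"
proof -
  assume m: "m \<le> n"
  have "resistance n m = (\<Sum>k\<in>{1..<m}. 1 / real k) / harmonic n"
    by (simp add: resistance_def weight_def sum_divide_distrib)
  also have "(\<Sum>k\<in>{1..<m}. 1 / real k) \<le> harmonic n"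
    unfolding harmonic_def using m by (intro sum_mono2) auto
  finally show ?thesis using harmonic_ge_1[OF n] by (simp add: divide_right_mono)
qed

end

section \<open>Solution of the circuit for a fixed input\<close>

locale network =
  fixes n :: nat and c :: real and x :: "nat \<Rightarrow> nat"
  assumes n: "0 < n" and c: "0 < c"
begin

definition reach :: "nat \<Rightarrow> nat \<Rightarrow> bool" where
  "reach l i \<longleftrightarrow> x l = 2 \<and> (\<forall>j. l < j \<and> j < i \<longrightarrow> x j = 0)"

definition seg :: "nat \<Rightarrow> nat \<Rightarrow> bool" where
  "seg l r \<longleftrightarrow> l < r \<and> r < n \<and> reach l r \<and> x r = 2"

text \<open>By \<open>seg_unique\<close> line \<open>l\<close> has at most one available path to the
  target. The 2 stands for its unit edges \<open>First\<close> and \<open>Last\<close>, in series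
  with the line edges between them.\<close>

definition conductance :: "nat \<Rightarrow> real" where
  "conductance l = (if \<exists>r. seg l r then 1 / (2 + resistance n ((THE r. seg l r) - l)) else 0)"

definition total :: real where
  "total = (\<Sum>l<n. conductance l)"

text \<open>The solution \<open>p\<close> of the current balance
  \<open>sqrt c * (1 - sqrt c * p) = p * total\<close> at the source.\<close>

definition source_potential :: real where
  "source_potential = sqrt c / (c + total)"

definition current :: "nat \<Rightarrow> real" where
  "current l = source_potential * conductance l"

definition potential :: "nat \<Rightarrow> nat \<Rightarrow> real" where
  "potential l i = (if reach l i then source_potential - current l * (1 + resistance n (i - l)) else 0)"

fun drop_vec :: "edge \<Rightarrow> real" where
  "drop_vec Loop = sqrt c * source_potential"
| "drop_vec (First l) = source_potential - potential l (Suc l)"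
| "drop_vec (Mid l i) = sqrt (weight n (i - l)) * (potential l i - potential l (Suc i))"
| "drop_vec (Last l i) = potential l i"

definition avail :: "edge \<Rightarrow> bool" where
  "avail e \<longleftrightarrow> test e (x (position e))"

text \<open>Defined as the remainder of the start vector, so the decomposition holds outright and
  the content moves to \<open>flow_orthogonal\<close>. On the lines it is the scaled current with a
  negative sign.\<close>

definition flow :: "edge \<Rightarrow> real" where
  "flow e = (if e = Loop then 1 else 0) - (if avail e then drop_vec e else 0)"

lemma seg_iff: "seg l r \<longleftrightarrow> bounded_segment n x l r"
  using n by (auto simp: seg_def bounded_segment_def reach_def)

lemma seg_unique:
  assumes "seg l r" "seg l r'"
  shows "r = r'"
proof -
  have "\<not> r < r'" "\<not> r' < r" using assms by (auto simp: seg_def reach_def)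
  then show ?thesis by simp
qed

lemma conductance_seg:
  assumes "seg l r"
  shows "conductance l = 1 / (2 + resistance n (r - l))"
proof -
  have "(THE r. seg l r) = r" using assms seg_unique by (intro the_equality)
  moreover have "\<exists>r. seg l r" using assms by blast
  ultimately show ?thesis by (simp add: conductance_def)
qed

text \<open>The path of a segment has resistance between 2 and 3.\<close>

lemma conductance_bounds:
  "0 \<le> conductance l" "conductance l \<le> 1 / 2" "seg l r \<Longrightarrow> 1 / 3 \<le> conductance l"
proof -
  have *: "0 \<le> conductance l \<and> conductance l \<le> 1 / 2 \<and> 1 / 3 \<le> conductance l" if s: "seg l r" for r
  proof -
    have "r - l \<le> n" using s by (auto simp: seg_def)
    then have "0 \<le> resistance n (r - l)" "resistance n (r - l) \<le> 1"
      using resistance_nonneg[OF n] resistance_le_1[OF n] by auto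
    then show ?thesis unfolding conductance_seg[OF s] by (simp add: field_simps)
  qed
  then show "0 \<le> conductance l" "conductance l \<le> 1 / 2"
    by (cases "\<exists>r. seg l r"; auto simp: conductance_def)+
  show "seg l r \<Longrightarrow> 1 / 3 \<le> conductance l" using * by simp
qed

lemma total_bounds: "0 \<le> total" "total \<le> n / 2"
proof -
  show "0 \<le> total" unfolding total_def by (intro sum_nonneg conductance_bounds)
  have "total \<le> (\<Sum>l<n. 1 / 2)" unfolding total_def by (intro sum_mono conductance_bounds)
  then show "total \<le> n / 2" by simp
qed

lemma total_ge: "seg l r \<Longrightarrow> 1 / 3 \<le> total"
proof -
  assume s: "seg l r"
  then have "conductance l \<le> total"
    unfolding total_def by (intro member_le_sum conductance_bounds) (auto simp: seg_def)
  then show ?thesis using conductance_bounds(3)[OF s] by simp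
qed

lemma source_potential_nonneg: "0 \<le> source_potential"
  using c total_bounds by (simp add: source_potential_def)

lemma source_potential_sq: "source_potential\<^sup>2 \<le> 1 / c"
proof -
  have "c * c \<le> (c + total)\<^sup>2"
    using c total_bounds(1) by (simp add: power2_eq_square mult_mono)
  then show ?thesis
    using c total_bounds(1) by (simp add: source_potential_def power_divide field_simps power2_eq_square add_pos_nonneg)
qed

lemma reach_Suc: "l < i \<Longrightarrow> reach l (Suc i) \<longleftrightarrow> reach l i \<and> x i = 0"
  by (auto simp: reach_def less_Suc_eq)

lemma drop_First: "x l = 2 \<Longrightarrow> drop_vec (First l) = current l"
  by (simp add: potential_def reach_def resistance_1[OF n])

lemma drop_Mid:
  assumes "l < i" "x i = 0"
  shows "drop_vec (Mid l i) = (if reach l i then current l / sqrt (weight n (i - l)) else 0)"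
proof -
  have w: "weight n (i - l) > 0" using weight_ge[OF n, of "i - l"] assms by linarith
  have "Suc i - l = Suc (i - l)" "1 \<le> i - l" using assms by auto
  then have "resistance n (Suc i - l) = resistance n (i - l) + 1 / weight n (i - l)"
    using resistance_Suc[OF n, of "i - l"] by simp
  moreover have "sqrt (weight n (i - l)) * (current l / weight n (i - l)) = current l / sqrt (weight n (i - l))"
    using w by (simp add: field_simps)
  ultimately show ?thesis
    using assms by (auto simp: potential_def reach_Suc algebra_simps)
qed

text \<open>The source potential equals the current times the whole resistance
  \<open>2 + resistance n (i - l)\<close>, and before the last edge all but the final unit of it is
  used up.\<close>

lemma drop_Last:
  assumes "l < i" "i < n" "x i = 2"
  shows "drop_vec (Last l i) = (if reach l i then current l else 0)"
proof (cases "reach l i")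
  case True
  then have s: "seg l i" using assms by (simp add: seg_def)
  have "0 < 2 + resistance n (i - l)" using resistance_nonneg[OF n, of "i - l"] by simp
  then show ?thesis
    using True by (simp add: potential_def current_def conductance_seg[OF s] field_simps)
qed (simp add: potential_def)

lemma current_eq_0:
  assumes "reach l i" "l < i" "i = n \<or> x i = 1"
  shows "current l = 0"
proof -
  have "\<not> seg l r" for r
  proof
    assume s: "seg l r"
    then have "\<not> i < r" "\<not> r < i" "r \<noteq> i" using assms by (auto simp: seg_def reach_def)
    then show False by simp
  qed
  then show ?thesis by (simp add: current_def conductance_def)
qed

lemma potential_bounds:
  assumes "l < i"
  shows "0 \<le> potential l i" "potential l i \<le> (if reach l i then source_potential else 0)"
proof -
  have "conductance l * (1 + resistance n (i - l)) \<le> 1" if r: "reach l i"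
  proof (cases "\<exists>r. seg l r")
    case True
    then obtain r where s: "seg l r" by blast
    have "i \<le> r" using r s assms by (auto simp: seg_def reach_def not_less[symmetric])
    then have "resistance n (i - l) \<le> resistance n (r - l)" by (intro resistance_mono[OF n]) auto
    moreover have "0 < 2 + resistance n (r - l)" using resistance_nonneg[OF n, of "r - l"] by simp
    ultimately show ?thesis by (simp add: conductance_seg[OF s] field_simps)
  qed (simp add: conductance_def)
  then have "source_potential * (conductance l * (1 + resistance n (i - l))) \<le> source_potential * 1"
    if "reach l i" using that source_potential_nonneg by (intro mult_left_mono) auto
  then show "0 \<le> potential l i" by (simp add: potential_def current_def mult.assoc)
  have "0 \<le> current l * (1 + resistance n (i - l))"
    unfolding current_def using source_potential_nonneg conductance_bounds(1) resistance_nonneg[OF n]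
    by (intro mult_nonneg_nonneg add_nonneg_nonneg) auto
  then show "potential l i \<le> (if reach l i then source_potential else 0)"
    by (simp add: potential_def)
qed

lemma flow_Loop: "flow Loop = 1 - sqrt c * source_potential"
  by (simp add: flow_def avail_def)

lemma flow_First: "flow (First l) = (if x l = 2 then - current l else 0)"
  using drop_First[of l] by (simp add: flow_def avail_def del: drop_vec.simps)

lemma flow_Mid: "l < i \<Longrightarrow> flow (Mid l i) =
    (if x i = 0 \<and> reach l i then - current l / sqrt (weight n (i - l)) else 0)"
  using drop_Mid[of l i] by (simp add: flow_def avail_def del: drop_vec.simps)

lemma flow_Last: "l < i \<Longrightarrow> i < n \<Longrightarrow> flow (Last l i) = (if seg l i then - current l else 0)"
  using drop_Last[of l i] by (simp add: flow_def avail_def seg_def del: drop_vec.simps)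

lemma flow_avail: "\<not> avail e \<Longrightarrow> flow e = 0"
  by (cases e) (auto simp: flow_def avail_def)

section \<open>Kirchhoff's laws\<close>

lemma start_decomposition:
  "(if e = Loop then 1 else 0) = flow e + (if avail e then drop_vec e else 0)"
  by (simp add: flow_def)

text \<open>Conservation of current. What enters a reached vertex leaves through \<open>Mid\<close>
  if the value is 0 and through \<open>Last\<close> if it is 2. At a 1 or at \<open>i = n\<close>
  there is no exit, but then the line carries no current. Values below 3 make these cases
  exhaustive.\<close>

lemma flow_orthogonal:
  assumes "u \<in> vertex_vecs n c"
    and x: "\<And>i. i < n \<Longrightarrow> x i < 3"
  shows "(\<Sum>e\<in>edges n. u e * flow e) = 0"
proof (cases "u = source_vec c")
  case True
  have "(\<Sum>l<n. if x l = 2 then - current l else 0) = (\<Sum>l<n. - current l)"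
    by (intro sum.cong) (auto simp: current_def conductance_def seg_def reach_def)
  also have "\<dots> = - source_potential * total"
    by (simp add: current_def total_def sum_negf sum_distrib_left)
  finally have "(\<Sum>e\<in>edges n. u e * flow e) =
      sqrt c * (1 - sqrt c * source_potential) - source_potential * total"
    by (simp add: True sum_edges flow_Loop flow_First)
  also have "\<dots> = sqrt c - source_potential * (c + total)"
    using c by (simp add: algebra_simps)
  also have "\<dots> = 0"
    using c total_bounds(1) by (simp add: source_potential_def)
  finally show ?thesis .
next
  case False
  then obtain l i where u: "u = vertex_vec n l i" and l: "l < n" "l < i" "i \<le> n"
    using assms(1) by (auto simp: vertex_vecs_def)
  let ?w = "\<lambda>k. sqrt (weight n (k - l))"
  have first: "(\<Sum>l'<n. u (First l') * flow (First l')) = (if i = Suc l then - flow (First l) else 0)"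
  proof -
    have "(\<Sum>l'<n. u (First l') * flow (First l')) =
        (\<Sum>l'<n. if l' = l then (if i = Suc l then - flow (First l) else 0) else 0)"
      unfolding u by (intro sum.cong) auto
    then show ?thesis using l by simp
  qed
  \<comment> \<open>The vertex \<open>(l, i)\<close> meets \<open>Mid l i\<close> and
    \<open>Mid l (i - 1)\<close>; for \<open>i = Suc l\<close> the second does not exist and
    \<open>First l\<close> takes its place.\<close>
  have mid: "(\<Sum>l'<n. \<Sum>k\<in>{l'<..<n}. u (Mid l' k) * flow (Mid l' k)) =
      (if i < n then ?w i * flow (Mid l i) else 0) - (if i \<noteq> Suc l then ?w (i - 1) * flow (Mid l (i - 1)) else 0)"
  proof -
    have "(\<Sum>l'<n. \<Sum>k\<in>{l'<..<n}. u (Mid l' k) * flow (Mid l' k)) =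
        (\<Sum>l'<n. if l' = l then \<Sum>k\<in>{l<..<n}. (if k = i then ?w i * flow (Mid l i) else 0)
          - (if k = i - 1 then ?w (i - 1) * flow (Mid l (i - 1)) else 0) else 0)"
      unfolding u using l by (intro sum.cong refl) (auto intro!: sum.cong sum.neutral simp: algebra_simps)
    also have "\<dots> = (\<Sum>k\<in>{l<..<n}. (if k = i then ?w i * flow (Mid l i) else 0)
          - (if k = i - 1 then ?w (i - 1) * flow (Mid l (i - 1)) else 0))"
      using l by simp
    also have "\<dots> = (if i < n then ?w i * flow (Mid l i) else 0)
        - (if i \<noteq> Suc l then ?w (i - 1) * flow (Mid l (i - 1)) else 0)"
      unfolding sum_subtractf sum.delta[OF finite_greaterThanLessThan] using l by auto
    finally show ?thesis .
  qed
  have last: "(\<Sum>l'<n. \<Sum>k\<in>{l'<..<n}. u (Last l' k) * flow (Last l' k)) = (if i < n then flow (Last l i) else 0)"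
  proof -
    have "(\<Sum>l'<n. \<Sum>k\<in>{l'<..<n}. u (Last l' k) * flow (Last l' k)) =
        (\<Sum>l'<n. if l' = l then \<Sum>k\<in>{l<..<n}. (if k = i then flow (Last l i) else 0) else 0)"
      unfolding u by (intro sum.cong refl) (auto simp: if_distrib[of "\<lambda>y. y * _"] cong: if_cong intro!: sum.neutral)
    also have "\<dots> = (\<Sum>k\<in>{l<..<n}. if k = i then flow (Last l i) else 0)"
      using l by simp
    also have "\<dots> = (if i < n then flow (Last l i) else 0)"
      unfolding sum.delta[OF finite_greaterThanLessThan] using l by auto
    finally show ?thesis .
  qed
  have w: "?w k \<noteq> 0" if "l < k" for k
    using weight_ge[OF n, of "k - l"] that by (cases "k - l") auto
  have "u Loop = 0" by (simp add: u)
  then have "(\<Sum>e\<in>edges n. u e * flow e) = (if i = Suc l then - flow (First l) else - (?w (i - 1) * flow (Mid l (i - 1))))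
      + (if i < n then ?w i * flow (Mid l i) + flow (Last l i) else 0)"
    unfolding sum_edges first mid last by simp
  also have "(if i = Suc l then - flow (First l) else - (?w (i - 1) * flow (Mid l (i - 1)))) =
      (if reach l i then current l else 0)"
  proof (cases "i = Suc l")
    case True
    then show ?thesis by (auto simp: flow_First reach_def)
  next
    case False
    then have "l < i - 1" "Suc (i - 1) = i" using l by auto
    moreover from this have "reach l i \<longleftrightarrow> reach l (i - 1) \<and> x (i - 1) = 0"
      using reach_Suc[of l "i - 1"] by simp
    ultimately show ?thesis using w[of "i - 1"] False by (simp add: flow_Mid)
  qed
  also have "(if i < n then ?w i * flow (Mid l i) + flow (Last l i) else 0) = (if reach l i then - current l else 0)"
  proof (cases "i < n")
    case True
    then have "x i = 0 \<or> x i = 1 \<or> x i = 2" using x[of i] by linarith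
    then show ?thesis
      using True l w[of i] current_eq_0[of l i] by (auto simp: flow_Mid flow_Last seg_def)
  next
    case False
    then show ?thesis using l current_eq_0[of l i] by auto
  qed
  finally show ?thesis by simp
qed

text \<open>A gradient combines the vertex rows with the potentials as coefficients; the target
  contributes nothing, having potential 0.\<close>

lemma drop_vec_combination:
  assumes "e \<in> edges n"
  shows "drop_vec e = source_potential * source_vec c e +
    (\<Sum>l<n. \<Sum>i\<in>{l<..n}. potential l i * vertex_vec n l i e)"
proof (cases e)
  case Loop
  then show ?thesis by simp
next
  case (First l)
  then have l: "l < n" using assms by (auto simp: edges_def)
  have "(\<Sum>l'<n. \<Sum>i\<in>{l'<..n}. potential l' i * vertex_vec n l' i e) =
      (\<Sum>l'<n. if l' = l then \<Sum>i\<in>{l<..n}. if i = Suc l then - potential l (Suc l) else 0 else 0)"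
    unfolding First by (intro sum.cong refl) (auto simp: if_distrib[of "\<lambda>y. _ * y"] cong: if_cong intro!: sum.neutral)
  also have "\<dots> = - potential l (Suc l)"
    using l by (simp add: sum.delta)
  finally show ?thesis by (simp add: First)
next
  case (Mid l k)
  then have l: "l < n" "l < k" "k < n" using assms by (auto simp: edges_def)
  have "(\<Sum>l'<n. \<Sum>i\<in>{l'<..n}. potential l' i * vertex_vec n l' i e) =
      (\<Sum>l'<n. if l' = l then \<Sum>i\<in>{l<..n}. (if i = k then sqrt (weight n (k - l)) * potential l k else 0)
        - (if i = Suc k then sqrt (weight n (k - l)) * potential l (Suc k) else 0) else 0)"
    unfolding Mid by (intro sum.cong refl) (auto intro!: sum.cong sum.neutral)
  also have "\<dots> = drop_vec e"
    using l by (simp add: Mid sum_subtractf sum.delta algebra_simps)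
  finally show ?thesis by (simp add: Mid)
next
  case (Last l k)
  then have l: "l < n" "l < k" "k < n" using assms by (auto simp: edges_def)
  have "(\<Sum>l'<n. \<Sum>i\<in>{l'<..n}. potential l' i * vertex_vec n l' i e) =
      (\<Sum>l'<n. if l' = l then \<Sum>i\<in>{l<..n}. if i = k then potential l k else 0 else 0)"
    unfolding Last by (intro sum.cong refl) (auto simp: if_distrib[of "\<lambda>y. _ * y"] cong: if_cong intro!: sum.neutral)
  also have "\<dots> = potential l k"
    using l by (simp add: sum.delta)
  finally show ?thesis by (simp add: Last)
qed

lemma drop_vec_fixed:
  assumes R: "\<forall>u\<in>vertex_vecs n c. \<forall>a\<in>edges n. (\<Sum>b\<in>edges n. R a b * u b) = u a"
    and e: "e \<in> edges n"
  shows "(\<Sum>e'\<in>edges n. R e e' * drop_vec e') = drop_vec e"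
proof -
  have fixed: "(\<Sum>b\<in>edges n. R e b * source_vec c b) = source_vec c e"
    "l < n \<Longrightarrow> i \<in> {l<..n} \<Longrightarrow> (\<Sum>b\<in>edges n. R e b * vertex_vec n l i b) = vertex_vec n l i e" for l i
    using R e by (auto simp: vertex_vecs_def)
  have "(\<Sum>e'\<in>edges n. R e e' * drop_vec e') = (\<Sum>e'\<in>edges n. source_potential * (R e e' * source_vec c e') +
      (\<Sum>l<n. \<Sum>i\<in>{l<..n}. potential l i * (R e e' * vertex_vec n l i e')))"
    using drop_vec_combination by (intro sum.cong) (simp_all add: algebra_simps sum_distrib_left)
  also have "\<dots> = source_potential * source_vec c e +
      (\<Sum>e'\<in>edges n. \<Sum>l<n. \<Sum>i\<in>{l<..n}. potential l i * (R e e' * vertex_vec n l i e'))"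
    by (simp only: sum.distrib sum_distrib_left[symmetric] fixed(1))
  also have "(\<Sum>e'\<in>edges n. \<Sum>l<n. \<Sum>i\<in>{l<..n}. potential l i * (R e e' * vertex_vec n l i e')) =
      (\<Sum>l<n. \<Sum>e'\<in>edges n. \<Sum>i\<in>{l<..n}. potential l i * (R e e' * vertex_vec n l i e'))"
    by (rule sum.swap)
  also have "\<dots> = (\<Sum>l<n. \<Sum>i\<in>{l<..n}. \<Sum>e'\<in>edges n. potential l i * (R e e' * vertex_vec n l i e'))"
    by (rule sum.cong[OF refl], rule sum.swap)
  also have "\<dots> = (\<Sum>l<n. \<Sum>i\<in>{l<..n}. potential l i * vertex_vec n l i e)"
    using fixed(2) by (intro sum.cong refl) (simp add: sum_distrib_left[symmetric])
  finally show ?thesis using drop_vec_combination[OF e] by simp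
qed

section \<open>Squared norm of the potential drops\<close>

definition reachable :: "nat \<Rightarrow> nat set" where
  "reachable l = {i \<in> {l<..<n}. reach l i}"

lemma finite_reachable: "finite (reachable l)"
  by (simp add: reachable_def)

text \<open>If \<open>l < l'\<close> and both reached \<open>i\<close>, position \<open>l'\<close>
  would carry both a 0 and a 2.\<close>

lemma sum_card_reachable: "(\<Sum>l<n. card (reachable l)) \<le> n"
proof -
  have "reachable l \<inter> reachable l' = {}" if "l \<noteq> l'" for l l'
  proof -
    have "\<not> (reach l i \<and> reach l' i)" if "l < i" "l' < i" for i
      using that \<open>l \<noteq> l'\<close> unfolding reach_def by (metis nat_neq_iff zero_neq_numeral)
    then show ?thesis by (auto simp: reachable_def)
  qed
  then have "(\<Sum>l<n. card (reachable l)) = card (\<Union>l<n. reachable l)"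
    by (intro card_UN_disjoint[symmetric]) (auto simp: finite_reachable)
  also have "\<dots> \<le> card {..<n}"
    by (intro card_mono) (auto simp: reachable_def)
  finally show ?thesis by simp
qed

lemma sum_indicator_reachable: "(\<Sum>i\<in>{l<..<n}. if reach l i then a else 0) = real (card (reachable l)) * a"
  by (simp add: reachable_def sum.If_cases Int_def)

lemma sum_drop_Last: "(\<Sum>i\<in>{l<..<n}. (drop_vec (Last l i))\<^sup>2) \<le> real (card (reachable l)) * source_potential\<^sup>2"
proof -
  have "(\<Sum>i\<in>{l<..<n}. (drop_vec (Last l i))\<^sup>2) \<le> (\<Sum>i\<in>{l<..<n}. if reach l i then source_potential\<^sup>2 else 0)"
  proof (intro sum_mono)
    fix i assume "i \<in> {l<..<n}"
    then show "(drop_vec (Last l i))\<^sup>2 \<le> (if reach l i then source_potential\<^sup>2 else 0)"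
      using potential_bounds[of l i] by (auto intro: power_mono)
  qed
  then show ?thesis by (simp only: sum_indicator_reachable)
qed

lemma sum_drop_Mid:
  "(\<Sum>i\<in>{l<..<n}. (drop_vec (Mid l i))\<^sup>2) \<le> 2 * harmonic n * real (card (reachable l)) * source_potential\<^sup>2"
proof -
  let ?h = "harmonic n" and ?p = "source_potential\<^sup>2"
  let ?stop = "\<lambda>i. reach l i \<and> x i \<noteq> 0"
  have h: "1 \<le> ?h" by (rule harmonic_ge_1[OF n])
  have "(drop_vec (Mid l i))\<^sup>2 \<le> (if reach l i then ?h * ?p else 0) + (if ?stop i then real (i - l) * (?h * ?p) else 0)"
    if i: "i \<in> {l<..<n}" for i
  proof -
    have "1 \<le> i - l" using i by auto
    then have weight: "1 \<le> weight n (i - l)" by (rule weight_ge[OF n])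
    show ?thesis
    proof (cases "reach l i \<and> x i = 0")
      case True
      have "0 \<le> current l" "current l \<le> source_potential"
        unfolding current_def using source_potential_nonneg conductance_bounds[of l]
        by (auto intro: mult_left_le)
      then have "(current l)\<^sup>2 / weight n (i - l) \<le> ?p / 1"
        using weight by (intro frac_le power_mono) auto
      also have "\<dots> \<le> ?h * ?p" using h by (simp add: mult_right_mono[of 1 ?h ?p, simplified])
      finally show ?thesis
        using True i weight by (simp add: drop_Mid power_divide del: drop_vec.simps)
    next
      case False
      then have "potential l (Suc i) = 0" using i by (auto simp: potential_def reach_Suc)
      then have d: "(drop_vec (Mid l i))\<^sup>2 = weight n (i - l) * (potential l i)\<^sup>2"
        using weight by (simp add: power_mult_distrib)
      also have "\<dots> \<le> weight n (i - l) * (if reach l i then ?p else 0)"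
        using potential_bounds[of l i] i weight by (intro mult_left_mono) (auto intro: power_mono)
      also have "\<dots> \<le> (if ?stop i then real (i - l) * (?h * ?p) else 0)"
        using False by (auto simp: weight_def)
      finally show ?thesis using h by (auto intro: order_trans)
    qed
  qed
  then have "(\<Sum>i\<in>{l<..<n}. (drop_vec (Mid l i))\<^sup>2) \<le>
      (\<Sum>i\<in>{l<..<n}. (if reach l i then ?h * ?p else 0) + (if ?stop i then real (i - l) * (?h * ?p) else 0))"
    by (rule sum_mono)
  also have "\<dots> = real (card (reachable l)) * (?h * ?p) +
      (\<Sum>i\<in>{l<..<n}. if ?stop i then real (i - l) * (?h * ?p) else 0)"
    by (simp only: sum.distrib sum_indicator_reachable)
  also have "(\<Sum>i\<in>{l<..<n}. if ?stop i then real (i - l) * (?h * ?p) else 0) \<le> real (card (reachable l)) * (?h * ?p)"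
  proof (cases "\<exists>i\<in>{l<..<n}. ?stop i")
    case True
    then obtain i where i: "i \<in> {l<..<n}" "?stop i" by blast
    have unique: "?stop j \<longleftrightarrow> j = i" if j: "j \<in> {l<..<n}" for j
    proof
      assume s: "?stop j"
      then have "\<not> j < i" "\<not> i < j" using i j by (auto simp: reach_def)
      then show "j = i" by simp
    qed (use i in auto)
    have "(\<Sum>j\<in>{l<..<n}. if ?stop j then real (j - l) * (?h * ?p) else 0) =
        (\<Sum>j\<in>{l<..<n}. if j = i then real (i - l) * (?h * ?p) else 0)"
      using unique by (intro sum.cong) auto
    also have "\<dots> = real (i - l) * (?h * ?p)" using i by simp
    also have "\<dots> \<le> real (card (reachable l)) * (?h * ?p)"
    proof -
      have "{l<..i} \<subseteq> reachable l" using i by (auto simp: reachable_def reach_def)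
      then have "card {l<..i} \<le> card (reachable l)" by (intro card_mono finite_reachable)
      then show ?thesis using h by (intro mult_right_mono) auto
    qed
    finally show ?thesis .
  next
    case False
    then have "(\<Sum>i\<in>{l<..<n}. if ?stop i then real (i - l) * (?h * ?p) else 0) = 0"
      by (intro sum.neutral) auto
    then show ?thesis using h by simp
  qed
  finally show ?thesis by (simp add: algebra_simps)
qed

lemma drop_vec_norm:
  assumes "c \<le> n"
  shows "(\<Sum>e\<in>edges n. (drop_vec e)\<^sup>2) \<le> 5 * harmonic n * n / c"
proof -
  let ?h = "harmonic n" and ?p = "source_potential\<^sup>2"
  have h: "1 \<le> ?h" by (rule harmonic_ge_1[OF n])
  have card: "(\<Sum>l<n. real (card (reachable l))) \<le> n"
    using sum_card_reachable by (simp only: of_nat_sum[symmetric] of_nat_le_iff)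
  have loop: "(drop_vec Loop)\<^sup>2 \<le> 1"
  proof -
    have "c * ?p \<le> c * (1 / c)" using c source_potential_sq by (intro mult_left_mono) auto
    then show ?thesis using c by (simp add: power_mult_distrib)
  qed
  have first: "(\<Sum>l<n. (drop_vec (First l))\<^sup>2) \<le> n * ?p"
  proof -
    have "(drop_vec (First l))\<^sup>2 \<le> ?p" for l
      using potential_bounds[of l "Suc l"] source_potential_nonneg
      by (auto intro!: power_mono split: if_splits)
    then have "(\<Sum>l<n. (drop_vec (First l))\<^sup>2) \<le> (\<Sum>l<n. ?p)" by (intro sum_mono)
    then show ?thesis by simp
  qed
  have mid: "(\<Sum>l<n. \<Sum>i\<in>{l<..<n}. (drop_vec (Mid l i))\<^sup>2) \<le> n * (2 * ?h * ?p)"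
  proof -
    have "(\<Sum>l<n. \<Sum>i\<in>{l<..<n}. (drop_vec (Mid l i))\<^sup>2) \<le> (\<Sum>l<n. real (card (reachable l)) * (2 * ?h * ?p))"
    proof (intro sum_mono)
      show "(\<Sum>i\<in>{l<..<n}. (drop_vec (Mid l i))\<^sup>2) \<le> real (card (reachable l)) * (2 * ?h * ?p)" for l
        using sum_drop_Mid[of l] by (simp only: mult_ac)
    qed
    also have "\<dots> \<le> n * (2 * ?h * ?p)"
      unfolding sum_distrib_right[symmetric] using card h by (intro mult_right_mono) auto
    finally show ?thesis .
  qed
  have last: "(\<Sum>l<n. \<Sum>i\<in>{l<..<n}. (drop_vec (Last l i))\<^sup>2) \<le> n * ?p"
  proof -
    have "(\<Sum>l<n. \<Sum>i\<in>{l<..<n}. (drop_vec (Last l i))\<^sup>2) \<le> (\<Sum>l<n. real (card (reachable l)) * ?p)"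
      by (intro sum_mono sum_drop_Last)
    also have "\<dots> \<le> n * ?p"
      unfolding sum_distrib_right[symmetric] using card by (intro mult_right_mono) auto
    finally show ?thesis .
  qed
  have "(\<Sum>e\<in>edges n. (drop_vec e)\<^sup>2) \<le> 1 + n * ?p + n * (2 * ?h * ?p) + n * ?p"
    unfolding sum_edges using loop first mid last by linarith
  also have "\<dots> = 1 + (2 + 2 * ?h) * n * ?p" by (simp add: algebra_simps)
  also have "\<dots> \<le> 1 + (4 * ?h) * n * (1 / c)"
    using h source_potential_sq by (intro add_left_mono mult_mono) auto
  \<comment> \<open>Here \<open>c \<le> n\<close> absorbs the contribution 1 of the loop.\<close>
  also have "\<dots> \<le> ?h * n / c + (4 * ?h) * n * (1 / c)"
  proof -
    have "1 * c \<le> ?h * n" using h c assms by (intro mult_mono) auto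
    then show ?thesis using c by (simp add: field_simps)
  qed
  also have "\<dots> = 5 * ?h * n / c" by (simp add: field_simps)
  finally show ?thesis .
qed

text \<open>The squared flow on last edges is \<open>c / (c + total)^2\<close> times the sum of
  squared conductances, which is at least \<open>total / 3\<close>. This stays away from 0 when
  \<open>c\<close> and \<open>total\<close> are comparable.\<close>

lemma flow_success:
  assumes "c / 3 \<le> total" "total \<le> c"
  shows "1 / 16 \<le> (\<Sum>e\<in>edges n. case answer e of None \<Rightarrow> 0 | Some (l, r) \<Rightarrow> if seg l r then (flow e)\<^sup>2 else 0)"
proof -
  have "3 / 16 * (c + total)\<^sup>2 \<le> c * total"
  proof -
    \<comment> \<open>The product is exactly
      \<open>16 * c * total - 3 * (c + total)^2\<close>.\<close>
    have "0 \<le> (3 * total - c) * (3 * c - total)" using assms c by (intro mult_nonneg_nonneg) auto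
    then show ?thesis by (simp add: power2_eq_square algebra_simps)
  qed
  then have "1 / 16 \<le> source_potential\<^sup>2 * (1 / 3 * total)"
    using c total_bounds(1) by (simp add: source_potential_def power_divide field_simps add_pos_nonneg)
  also have "1 / 3 * total \<le> (\<Sum>l<n. (conductance l)\<^sup>2)"
    unfolding total_def sum_distrib_left
  proof (intro sum_mono)
    fix l
    show "1 / 3 * conductance l \<le> (conductance l)\<^sup>2"
    proof (cases "\<exists>r. seg l r")
      case True
      then have "1 / 3 \<le> conductance l" using conductance_bounds(3) by blast
      then show ?thesis
        unfolding power2_eq_square using conductance_bounds(1) by (intro mult_right_mono) auto
    qed (simp add: conductance_def)
  qed
  also have "source_potential\<^sup>2 * (\<Sum>l<n. (conductance l)\<^sup>2) = (\<Sum>l<n. (current l)\<^sup>2)"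
    by (simp add: current_def power_mult_distrib sum_distrib_left)
  also have "\<dots> \<le> (\<Sum>l<n. \<Sum>i\<in>{l<..<n}. if seg l i then (flow (Last l i))\<^sup>2 else 0)"
  proof (intro sum_mono)
    fix l
    show "(current l)\<^sup>2 \<le> (\<Sum>i\<in>{l<..<n}. if seg l i then (flow (Last l i))\<^sup>2 else 0)"
    proof (cases "\<exists>r. seg l r")
      case True
      then obtain r where s: "seg l r" by blast
      then have r: "r \<in> {l<..<n}" by (auto simp: seg_def)
      then have "(current l)\<^sup>2 = (if seg l r then (flow (Last l r))\<^sup>2 else 0)"
        using s by (simp add: flow_Last)
      also have "\<dots> \<le> (\<Sum>i\<in>{l<..<n}. if seg l i then (flow (Last l i))\<^sup>2 else 0)"
        using r by (intro member_le_sum) auto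
      finally show ?thesis .
    next
      case False
      then have "current l = 0" by (simp add: current_def conductance_def)
      then show ?thesis using False by simp
    qed
  qed
  also have "\<dots> = (\<Sum>e\<in>edges n. case answer e of None \<Rightarrow> 0 | Some (l, r) \<Rightarrow> if seg l r then (flow e)\<^sup>2 else 0)"
    by (simp add: sum_edges)
  finally show ?thesis by (simp add: mult_left_mono)
qed

end

subsection \<open>Realizable trade-offs\<close>

text \<open>\<open>\<beta>\<close> bounds the probability of a wrong pair and
  \<open>\<gamma> x\<close> that of \<open>None\<close>, whether or not \<open>None\<close> is
  correct. In sequence the first kind adds up and the second multiplies, so a single error bound
  would not compose.\<close>

definition realizable :: "nat \<Rightarrow> real \<Rightarrow> real \<Rightarrow> ((nat \<Rightarrow> nat) \<Rightarrow> real) \<Rightarrow> bool" where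
  "realizable n t \<beta> \<gamma> \<longleftrightarrow> (\<exists>A :: (nat, (nat \<times> nat) option) qalgorithm.
     query_algorithm n 3 A \<and> real (query_count (qa_steps A)) \<le> t \<and>
     (\<forall>x\<in>query_inputs n 3.
        output_prob n 3 A x (\<lambda>a. a \<noteq> None \<and> \<not> szbt_correct n x a) \<le> \<beta> \<and>
        output_prob n 3 A x (\<lambda>a. a = None) \<le> \<gamma> x))"

lemma realizable_mono:
  assumes "realizable n t \<beta> \<gamma>" "t \<le> t'" "\<beta> \<le> \<beta>'" "\<And>x. x \<in> query_inputs n 3 \<Longrightarrow> \<gamma> x \<le> \<gamma>' x"
  shows "realizable n t' \<beta>' \<gamma>'"
  using assms unfolding realizable_def by (meson order_trans)

text \<open>The neutral element of sequential composition, and the whole algorithm for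
  \<open>n = 1\<close>.\<close>

lemma realizable_trivial:
  assumes "0 < n"
  shows "realizable n 0 0 (\<lambda>_. 1)"
proof -
  define A :: "(nat, (nat \<times> nat) option) qalgorithm" where
    "A = \<lparr> qa_work = {0}, qa_start = 0, qa_steps = [], qa_output = (\<lambda>_. None) \<rparr>"
  have A: "query_algorithm n 3 A"
    using assms by (simp add: A_def query_algorithm_def valid_circuit_def)
  moreover have "query_count (qa_steps A) = 0" by (simp add: A_def query_count_def)
  moreover have "output_prob n 3 A x (\<lambda>a. a \<noteq> None \<and> \<not> szbt_correct n x a) = 0" for x
    by (simp add: A_def output_prob_def)
  ultimately show ?thesis
    unfolding realizable_def using output_prob_le_1[OF A] by (intro exI[of _ A]) simp
qed

lemma realizable_seq:
  assumes "realizable n t1 \<beta>1 \<gamma>1" "realizable n t2 \<beta>2 \<gamma>2"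
  shows "realizable n (t1 + t2) (\<beta>1 + \<beta>2) (\<lambda>x. \<gamma>1 x * \<gamma>2 x)"
proof -
  obtain A :: "(nat, (nat \<times> nat) option) qalgorithm" where algA: "query_algorithm n 3 A"
      "real (query_count (qa_steps A)) \<le> t1"
      "\<And>x. x \<in> query_inputs n 3 \<Longrightarrow> output_prob n 3 A x (\<lambda>a. a \<noteq> None \<and> \<not> szbt_correct n x a) \<le> \<beta>1"
      "\<And>x. x \<in> query_inputs n 3 \<Longrightarrow> output_prob n 3 A x (\<lambda>a. a = None) \<le> \<gamma>1 x"
    using assms(1) unfolding realizable_def by auto
  obtain B :: "(nat, (nat \<times> nat) option) qalgorithm" where algB: "query_algorithm n 3 B"
      "real (query_count (qa_steps B)) \<le> t2"
      "\<And>x. x \<in> query_inputs n 3 \<Longrightarrow> output_prob n 3 B x (\<lambda>a. a \<noteq> None \<and> \<not> szbt_correct n x a) \<le> \<beta>2"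
      "\<And>x. x \<in> query_inputs n 3 \<Longrightarrow> output_prob n 3 B x (\<lambda>a. a = None) \<le> \<gamma>2 x"
    using assms(2) unfolding realizable_def by auto
  interpret two_algorithms n 3 A B
    using algA(1) algB(1) by unfold_locales
  obtain D :: "(nat, (nat \<times> nat) option) qalgorithm" where D: "query_algorithm n 3 D"
      "query_count (qa_steps D) = query_count (qa_steps AB)"
      "\<And>x P. output_prob n 3 D x P = output_prob n 3 AB x P"
    using relabel_algorithm[OF valid, of to_nat] by auto
  have "real (query_count (qa_steps D)) \<le> t1 + t2"
    using algA(2) algB(2) by (simp add: D(2) query_count_try_in_order)
  moreover have "output_prob n 3 D x (\<lambda>a. a \<noteq> None \<and> \<not> szbt_correct n x a) \<le> \<beta>1 + \<beta>2"
    if "x \<in> query_inputs n 3" for x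
    using prob_Some_try_in_order[of x "\<lambda>a. \<not> szbt_correct n x a"] algA(3)[OF that] algB(3)[OF that]
    unfolding D(3) by linarith
  moreover have "output_prob n 3 D x (\<lambda>a. a = None) \<le> \<gamma>1 x * \<gamma>2 x"
    if "x \<in> query_inputs n 3" for x
    unfolding D(3) prob_None_try_in_order
    using algA(4)[OF that] algB(4)[OF that] output_prob_nonneg order_trans by (intro mult_mono) blast+
  ultimately show ?thesis
    unfolding realizable_def using D(1) by blast
qed

lemma realizable_sum:
  fixes m :: nat
  assumes "0 < n" "\<And>k. k < m \<Longrightarrow> realizable n (t k) (\<beta> k) (\<gamma> k)"
  shows "realizable n (\<Sum>k<m. t k) (\<Sum>k<m. \<beta> k) (\<lambda>x. \<Prod>k<m. \<gamma> k x)"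
  using assms(2)
proof (induction m)
  case 0
  then show ?case using realizable_trivial[OF assms(1)] by simp
next
  case (Suc m)
  then have "realizable n ((\<Sum>k<m. t k) + t m) ((\<Sum>k<m. \<beta> k) + \<beta> m) (\<lambda>x. (\<Prod>k<m. \<gamma> k x) * \<gamma> m x)"
    by (intro realizable_seq) auto
  then show ?case by simp
qed

lemma realizable_repeat:
  assumes "0 < n" "realizable n t \<beta> \<gamma>"
  shows "realizable n (real m * t) (real m * \<beta>) (\<lambda>x. \<gamma> x ^ m)"
  using realizable_sum[OF assms(1), of m "\<lambda>_. t" "\<lambda>_. \<beta>" "\<lambda>_. \<gamma>"] assms(2) by simp

lemma realizable_walk:
  assumes n: "0 < n" and c: "0 < c" "c \<le> real n" and T: "0 < T"
  defines "\<delta> \<equiv> 5 * harmonic n * n / (c * T\<^sup>2)"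
  shows "realizable n (3 * real T) \<delta>
    (\<lambda>x. if c / 3 \<le> network.total n x \<and> network.total n x \<le> c then 31 / 32 + \<delta> else 1)"
proof -
  obtain R where R: "projection_on (edges n) R"
      "\<forall>u\<in>vertex_vecs n c. \<forall>a\<in>edges n. (\<Sum>b\<in>edges n. R a b * u b) = u a"
      "\<forall>g. (\<forall>u\<in>vertex_vecs n c. (\<Sum>b\<in>edges n. u b * g b) = 0) \<longrightarrow>
        (\<forall>a\<in>edges n. (\<Sum>b\<in>edges n. R a b * g b) = 0)"
    using projection_exists[OF finite_vertex_vecs[of n c] finite_edges[of n]] by (elim exE conjE)
  interpret Q: quantum_walk n T "edges n" position test Loop R answer
    using n T R(1) by unfold_locales (auto simp: finite_edges position_less edges_def)
  obtain A :: "(nat, (nat \<times> nat) option) qalgorithm" where A: "query_algorithm n 3 A"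
      "query_count (qa_steps A) = query_count (qa_steps Q.algorithm)"
      "\<And>x P. output_prob n 3 A x P = output_prob n 3 Q.algorithm x P"
    using relabel_algorithm[OF Q.query_algorithm, of to_nat] by auto
  have "real (query_count (qa_steps A)) \<le> 3 * real T"
    by (simp add: A(2) Q.query_count_algorithm)
  moreover have "output_prob n 3 A x (\<lambda>a. a \<noteq> None \<and> \<not> szbt_correct n x a) \<le> \<delta> \<and>
      output_prob n 3 A x (\<lambda>a. a = None) \<le>
        (if c / 3 \<le> network.total n x \<and> network.total n x \<le> c then 31 / 32 + \<delta> else 1)"
    if x: "x \<in> query_inputs n 3" for x
  proof -
    interpret N: network n c x using n c by unfold_locales
    have x3: "x i < 3" if "i < n" for i using x that by (auto simp: query_inputs_def)
    have avail: "Q.avail x = N.avail" by (simp add: fun_eq_iff Q.avail_def N.avail_def)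
    let ?err = "\<lambda>e. (Q.average x e - N.flow e)\<^sup>2"
    have "(\<Sum>e\<in>edges n. ?err e) \<le> (\<Sum>e\<in>edges n. (N.drop_vec e)\<^sup>2) / T\<^sup>2"
    proof (rule Q.average_error)
      show "\<And>e. e \<in> edges n \<Longrightarrow> (\<Sum>e'\<in>edges n. R e e' * N.drop_vec e') = N.drop_vec e"
        by (rule N.drop_vec_fixed[OF R(2)])
      have "\<forall>u\<in>vertex_vecs n c. (\<Sum>e\<in>edges n. u e * N.flow e) = 0"
        using N.flow_orthogonal x3 by blast
      then show "\<And>e. e \<in> edges n \<Longrightarrow> (\<Sum>e'\<in>edges n. R e e' * N.flow e') = 0"
        using R(3) by blast
      show "\<And>e. \<not> Q.avail x e \<Longrightarrow> N.flow e = 0"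
        unfolding avail by (rule N.flow_avail)
      show "\<And>e. (if e = Loop then 1 else 0) = N.flow e + (if Q.avail x e then N.drop_vec e else 0)"
        unfolding avail by (rule N.start_decomposition)
    qed
    also have "\<dots> \<le> (5 * harmonic n * n / c) / T\<^sup>2"
      using N.drop_vec_norm[OF c(2)] by (intro divide_right_mono) auto
    also have "\<dots> = \<delta>" by (simp add: \<delta>_def)
    finally have err: "(\<Sum>e\<in>edges n. ?err e) \<le> \<delta>" .
    \<comment> \<open>Wrong pairs sit on edges without flow, so their amplitude is pure averaging
      error.\<close>
    have flow_bad: "N.flow e = 0"
      if e: "e \<in> edges n" "answer e \<noteq> None" "\<not> szbt_correct n x (answer e)" for e
    proof -
      obtain l i where last: "e = Last l i" "l < i" "i < n"
        using e(1,2) by (cases e) (auto simp: edges_def)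
      then have "\<not> N.seg l i" using e(3) by (simp add: szbt_correct_def N.seg_iff)
      then show ?thesis using last by (simp add: N.flow_Last)
    qed
    have "output_prob n 3 A x (\<lambda>a. a \<noteq> None \<and> \<not> szbt_correct n x a) \<le> (\<Sum>e\<in>edges n. ?err e)"
      unfolding A(3) Q.output_prob_algorithm[OF x]
      by (intro sum_mono) (use flow_bad in auto)
    also note err
    finally have bad: "output_prob n 3 A x (\<lambda>a. a \<noteq> None \<and> \<not> szbt_correct n x a) \<le> \<delta>" .
    have "output_prob n 3 A x (\<lambda>a. a = None) \<le> 31 / 32 + \<delta>"
      if total: "c / 3 \<le> N.total" "N.total \<le> c"
    proof -
      let ?F = "\<lambda>e. case answer e of None \<Rightarrow> 0 | Some (l, r) \<Rightarrow> if N.seg l r then (N.flow e)\<^sup>2 else 0"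
      \<comment> \<open>Replacing the flow by the average halves the success bound
        \<open>1 / 16\<close> and loses \<open>\<delta>\<close>, which explains
        \<open>31 / 32 + \<delta>\<close>.\<close>
      have half: "a\<^sup>2 / 2 - (b - a)\<^sup>2 \<le> b\<^sup>2" for a b :: real
      proof -
        have "0 \<le> (2 * b - a)\<^sup>2" by simp
        then show ?thesis by (simp add: power2_eq_square algebra_simps)
      qed
      have "1 / 32 - \<delta> \<le> (\<Sum>e\<in>edges n. ?F e) / 2 - (\<Sum>e\<in>edges n. ?err e)"
        using N.flow_success[OF total] err by simp
      also have "\<dots> = (\<Sum>e\<in>edges n. ?F e / 2 - ?err e)"
        by (simp add: sum_subtractf sum_divide_distrib)
      also have "\<dots> \<le> (\<Sum>e\<in>edges n. if answer e \<noteq> None \<and> True then (Q.average x e)\<^sup>2 else 0)"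
        using half by (intro sum_mono) (auto split: option.split)
      also have "\<dots> = output_prob n 3 A x (\<lambda>a. \<not> a = None)"
        unfolding A(3) using Q.output_prob_algorithm[OF x, of "\<lambda>_. True"] by simp
      also have "\<dots> = 1 - output_prob n 3 A x (\<lambda>a. a = None)"
        using output_prob_add_not[OF A(1), of x "\<lambda>a. a = None"] by simp
      finally show ?thesis by simp
    qed
    then show ?thesis using bad output_prob_le_1[OF A(1)] by simp
  qed
  ultimately show ?thesis unfolding realizable_def using A(1) by blast
qed

lemma geometric_sum_le:
  fixes q :: real
  assumes "0 \<le> q" "q < 1"
  shows "(\<Sum>k<m. q ^ k) \<le> 1 / (1 - q)"
  using assms by (subst sum_gp_strict) (simp add: divide_right_mono)

text \<open>The number of solutions is unknown, so all scales \<open>c = 2 ^ k\<close> of the source edge are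
  tried.  The running times decrease geometrically in \<open>k\<close>, slowly enough for the errors to
  stay summable.\<close>

lemma realizable_szbt:
  assumes n: "0 < n"
  shows "realizable n (433800 * sqrt (harmonic n * n)) (1 / 20)
    (\<lambda>x. if \<exists>l r. bounded_segment n x l r then 1 / 20 else 1)"
proof -
  define h where "h = harmonic n"
  have h: "1 \<le> h" unfolding h_def by (rule harmonic_ge_1[OF n])
  \<comment> \<open>Since \<open>total\<close> is at most \<open>n / 2 < 2 ^ L\<close>, the scales
    up to \<open>2 ^ L \<le> n\<close> suffice.\<close>
  obtain L where L: "2 ^ L \<le> n" "n < 2 ^ Suc L"
    using ex_power_ivl1[of 2 n] n by auto
  \<comment> \<open>The ratio must be below 1 for the running times to be summable and above
    \<open>1 / sqrt 2\<close> for the errors, which shrink like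
    \<open>1 / (2 * ratio^2) ^ k\<close>; \<open>4 / 5\<close> gives \<open>25 / 32\<close>.\<close>
  define S where "S k = sqrt (h * n) * (4 / 5) ^ k" for k :: nat
  \<comment> \<open>With 240 the wrong answers of 120 runs per scale add up to at most
    \<open>120 * (5 / 57600) * (32 / 7) = 1 / 21\<close>.\<close>
  define T where "T k = nat \<lceil>240 * S k\<rceil>" for k
  define \<delta> where "\<delta> k = 5 * h * n / (2 ^ k * (real (T k))\<^sup>2)" for k
  define \<gamma> where "\<gamma> k x = (if 2 ^ k / 3 \<le> network.total n x \<and> network.total n x \<le> 2 ^ k
    then 31 / 32 + \<delta> k else 1)" for k x
  have hn: "0 < h * n" using h n by simp
  have S2: "(S k)\<^sup>2 = h * n * (16 / 25) ^ k" for k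
  proof -
    have "((4 / 5 :: real) ^ k)\<^sup>2 = ((4 / 5)\<^sup>2) ^ k" by (simp only: power_mult[symmetric] mult.commute)
    then show ?thesis using hn by (simp add: S_def power_mult_distrib power2_eq_square[of "4 / 5 :: real"])
  qed
  have S_pos: "0 < S k" for k using hn by (simp add: S_def)
  have T_ge: "240 * S k \<le> T k" for k unfolding T_def by linarith
  have T_pos: "0 < T k" for k using T_ge[of k] S_pos[of k] by (cases "T k") auto
  have pow_le: "2 ^ k \<le> real n" if "k \<le> L" for k
  proof -
    have "(2::nat) ^ k \<le> 2 ^ L" using that by (intro power_increasing) auto
    then have "2 ^ k \<le> n" using L by linarith
    then have "real (2 ^ k) \<le> real n" by (simp only: of_nat_le_iff)
    then show ?thesis by simp
  qed
  have pow_mult: "2 ^ k * (16 / 25) ^ k = (32 / 25 :: real) ^ k" for k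
    by (subst power_mult_distrib[symmetric]) simp
  have \<delta>_le: "\<delta> k \<le> 5 / 57600 * (25 / 32) ^ k" for k
  proof -
    have "(240 * S k)\<^sup>2 \<le> (real (T k))\<^sup>2" using T_ge S_pos[of k] by (intro power_mono) auto
    then have "\<delta> k \<le> 5 * h * n / (2 ^ k * (240 * S k)\<^sup>2)"
      unfolding \<delta>_def using S_pos[of k] h by (intro divide_left_mono mult_left_mono) (auto intro!: mult_pos_pos T_pos)
    also have "\<dots> = 5 / 57600 * (1 / (2 ^ k * (16 / 25) ^ k))"
      using h n by (simp add: power_mult_distrib S2 field_simps)
    also have "1 / (2 ^ k * (16 / 25) ^ k) = (25 / 32 :: real) ^ k"
      unfolding pow_mult by (simp add: power_divide)
    finally show ?thesis .
  qed
  have \<delta>_nonneg: "0 \<le> \<delta> k" for k unfolding \<delta>_def using h by simp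
  have \<delta>_small: "\<delta> k \<le> 1 / 160" for k
  proof -
    have "(25 / 32 :: real) ^ k \<le> 1" by (intro power_le_one) auto
    then show ?thesis using \<delta>_le[of k] by simp
  qed
  have S_ge: "1 \<le> S k" if "k \<le> L" for k
  proof -
    have "1 \<le> (32 / 25 :: real) ^ k" by (intro one_le_power) auto
    also have "\<dots> = 2 ^ k * (16 / 25) ^ k" by (rule pow_mult[symmetric])
    also have "\<dots> \<le> (h * n) * (16 / 25) ^ k"
    proof (rule mult_right_mono)
      have "1 * real n \<le> h * n" using h by (intro mult_right_mono) auto
      then show "2 ^ k \<le> h * n" using pow_le[OF that] by linarith
    qed simp
    finally have "1\<^sup>2 \<le> (S k)\<^sup>2" by (simp add: S2)
    then show ?thesis by (rule power2_le_imp_le[OF _ less_imp_le[OF S_pos]])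
  qed
  \<comment> \<open>As \<open>1 \<le> S k\<close>, rounding up costs at most one more
    \<open>S k\<close>, and \<open>723 = 3 * 241\<close>.\<close>
  have T_le: "3 * real (T k) \<le> 723 * S k" if "k \<le> L" for k
    using S_ge[OF that] S_pos[of k] unfolding T_def by linarith
  \<comment> \<open>120 runs bring the failure probability \<open>39 / 40\<close> of a matching
    scale below \<open>1 / 20\<close>.\<close>
  have "realizable n (real 120 * (723 * S k)) (real 120 * \<delta> k) (\<lambda>x. \<gamma> k x ^ 120)" if k: "k < Suc L" for k
  proof -
    have "realizable n (3 * real (T k)) (\<delta> k) (\<gamma> k)"
      unfolding \<delta>_def \<gamma>_def[abs_def] h_def
      by (rule realizable_walk[OF n _ _ T_pos]) (use pow_le[of k] k in auto)
    then have "realizable n (723 * S k) (\<delta> k) (\<gamma> k)"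
      by (rule realizable_mono) (use T_le k in auto)
    then show ?thesis by (rule realizable_repeat[OF n])
  qed
  then have "realizable n (\<Sum>k<Suc L. real 120 * (723 * S k)) (\<Sum>k<Suc L. real 120 * \<delta> k)
      (\<lambda>x. \<Prod>k<Suc L. \<gamma> k x ^ 120)"
    by (rule realizable_sum[OF n])
  then show ?thesis
  proof (rule realizable_mono)
    have "(\<Sum>k<Suc L. real 120 * (723 * S k)) = 86760 * sqrt (h * n) * (\<Sum>k<Suc L. (4 / 5) ^ k)"
      unfolding S_def sum_distrib_left by (intro sum.cong) auto
    also have "\<dots> \<le> 86760 * sqrt (h * n) * (1 / (1 - 4 / 5))"
      using hn by (intro mult_left_mono geometric_sum_le) auto
    finally show "(\<Sum>k<Suc L. real 120 * (723 * S k)) \<le> 433800 * sqrt (harmonic n * n)"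
      by (simp add: h_def)
    have "(\<Sum>k<Suc L. real 120 * \<delta> k) \<le> (\<Sum>k<Suc L. 1 / 96 * (25 / 32) ^ k)"
      using \<delta>_le by (intro sum_mono) (simp add: field_simps)
    also have "\<dots> \<le> 1 / 96 * (1 / (1 - 25 / 32))"
      unfolding sum_distrib_left[symmetric] by (intro mult_left_mono geometric_sum_le) auto
    finally show "(\<Sum>k<Suc L. real 120 * \<delta> k) \<le> 1 / 20" by simp
    fix x
    have \<gamma>: "0 \<le> \<gamma> k x ^ 120" "\<gamma> k x ^ 120 \<le> 1" for k
    proof -
      have "0 \<le> \<gamma> k x" "\<gamma> k x \<le> 1" using \<delta>_nonneg[of k] \<delta>_small[of k] by (auto simp: \<gamma>_def)
      then show "0 \<le> \<gamma> k x ^ 120" "\<gamma> k x ^ 120 \<le> 1" by (auto intro: power_le_one)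
    qed
    show "(\<Prod>k<Suc L. \<gamma> k x ^ 120) \<le> (if \<exists>l r. bounded_segment n x l r then 1 / 20 else 1)"
    proof (cases "\<exists>l r. bounded_segment n x l r")
      case False
      then show ?thesis using \<gamma> by (simp only: if_False) (intro prod_le_1, auto)
    next
      case True
      \<comment> \<open>\<open>total\<close> does not depend on the conductance of the loop, so any
        positive value serves here.\<close>
      interpret N: network n 1 x using n by unfold_locales auto
      have total: "1 / 3 \<le> N.total" "N.total \<le> n / 2"
        using True N.total_ge N.total_bounds(2) by (auto simp: N.seg_iff)
      \<comment> \<open>Minimality gives \<open>total > 2 ^ k / 2\<close> for \<open>k > 0\<close>.
        For \<open>k = 0\<close> only \<open>total \<ge> 1 / 3\<close> is known, which is the reason
        for the window \<open>c / 3 \<le> total\<close>.\<close>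
      define k where "k = (LEAST k. N.total \<le> 2 ^ k)"
      have "N.total \<le> 2 ^ L"
      proof -
        have "real n < real (2 ^ Suc L)" using L(2) by (simp only: of_nat_less_iff)
        then show ?thesis using total(2) by simp
      qed
      then have k: "N.total \<le> 2 ^ k" "k \<le> L"
        unfolding k_def by (rule LeastI, rule Least_le)
      have "2 ^ k / 3 \<le> N.total"
      proof (cases k)
        case 0
        then show ?thesis using total by simp
      next
        case (Suc j)
        then have "\<not> N.total \<le> 2 ^ j" using not_less_Least[of j "\<lambda>k. N.total \<le> 2 ^ k"] by (simp add: k_def)
        then show ?thesis using total Suc by simp
      qed
      then have "\<gamma> k x = 31 / 32 + \<delta> k" using k by (simp add: \<gamma>_def)
      then have "\<gamma> k x \<le> 39 / 40" "0 \<le> \<gamma> k x" using \<delta>_small[of k] \<delta>_nonneg[of k] by auto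
      then have "\<gamma> k x ^ 120 \<le> (39 / 40) ^ 120" by (rule power_mono)
      also have "\<dots> \<le> 1 / 20" by (simp add: power_divide)
      finally have "\<gamma> k x ^ 120 \<le> 1 / 20" .
      moreover have "(\<Prod>k<Suc L. \<gamma> k x ^ 120) = \<gamma> k x ^ 120 * (\<Prod>k\<in>{..<Suc L} - {k}. \<gamma> k x ^ 120)"
        using k by (intro prod.remove) auto
      moreover have "(\<Prod>k\<in>{..<Suc L} - {k}. \<gamma> k x ^ 120) \<le> 1"
        using \<gamma> by (intro prod_le_1) auto
      ultimately show ?thesis
        using True \<gamma>(1)[of k] mult_left_le[of "\<Prod>k\<in>{..<Suc L} - {k}. \<gamma> k x ^ 120" "\<gamma> k x ^ 120"] by simp
    qed
  qed
qed

section \<open>From harmonic numbers to logarithms, and transfer to evaluated functions\<close>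

lemma output_prob_le_add:
  assumes "finite (qa_work A)" "\<And>a. P a \<Longrightarrow> P1 a \<or> P2 a"
  shows "output_prob N q A x P \<le> output_prob N q A x P1 + output_prob N q A x P2"
  unfolding output_prob_alt[OF assms(1)] sum.distrib[symmetric]
  using assms(2) by (intro sum_mono) auto

lemma szbt_algorithm_exists:
  assumes n: "1 \<le> n"
  shows "\<exists>A :: (nat, (nat \<times> nat) option) qalgorithm. query_algorithm n 3 A \<and>
    real (query_count (qa_steps A)) \<le> 867600 * sqrt (real n * ln (real n)) \<and>
    (\<forall>x\<in>query_inputs n 3. output_prob n 3 A x (\<lambda>a. \<not> szbt_correct n x a) \<le> 1 / 10)"
proof -
  have "realizable n (867600 * sqrt (real n * ln (real n))) (1 / 20)
    (\<lambda>x. if \<exists>l r. bounded_segment n x l r then 1 / 20 else 1)"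
  proof (cases "n = 1")
    \<comment> \<open>For \<open>n = 1\<close> the bound is 0 because \<open>ln 1 = 0\<close>, so no
      query is allowed; a single position has no segment and \<open>None\<close> is right.\<close>
    case True
    show ?thesis
      by (rule realizable_mono[OF realizable_trivial]) (use True in \<open>auto simp: bounded_segment_def\<close>)
  next
    case False
    then have n2: "2 \<le> n" using n by simp
    have "1 / 2 \<le> ln (2 :: real)"
      using ln_le_minus_one[of "1 / 2 :: real"] by (simp add: ln_div)
    also have "\<dots> \<le> ln (real n)" using n2 by simp
    finally have ln: "1 / 2 \<le> ln (real n)" .
    \<comment> \<open>The 1 in \<open>1 + ln n\<close> is at most \<open>2 * ln n\<close>; rounding
      the factor up to 4 makes it a square, which doubles the constant.\<close>
    have "harmonic n * n \<le> 4 * (real n * ln (real n))"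
    proof -
      have "harmonic n \<le> 4 * ln (real n)" using harmonic_le[of n] n ln by simp
      then have "harmonic n * n \<le> 4 * ln (real n) * n" by (intro mult_right_mono) auto
      then show ?thesis by (simp add: mult_ac)
    qed
    then have "sqrt (harmonic n * n) \<le> sqrt (4 * (real n * ln (real n)))" by (rule real_sqrt_le_mono)
    also have "\<dots> = 2 * sqrt (real n * ln (real n))" by (simp add: real_sqrt_mult)
    finally show ?thesis
      using n by (intro realizable_mono[OF realizable_szbt]) auto
  qed
  then obtain A :: "(nat, (nat \<times> nat) option) qalgorithm" where A: "query_algorithm n 3 A"
      "real (query_count (qa_steps A)) \<le> 867600 * sqrt (real n * ln (real n))"
      "\<And>x. x \<in> query_inputs n 3 \<Longrightarrow> output_prob n 3 A x (\<lambda>a. a \<noteq> None \<and> \<not> szbt_correct n x a) \<le> 1 / 20"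
      "\<And>x. x \<in> query_inputs n 3 \<Longrightarrow> output_prob n 3 A x (\<lambda>a. a = None) \<le>
        (if \<exists>l r. bounded_segment n x l r then 1 / 20 else 1)"
    unfolding realizable_def by blast
  have fin: "finite (qa_work A)" using A(1) by (simp add: query_algorithm_def valid_circuit_def)
  have "output_prob n 3 A x (\<lambda>a. \<not> szbt_correct n x a) \<le> 1 / 10" if x: "x \<in> query_inputs n 3" for x
  proof (cases "\<exists>l r. bounded_segment n x l r")
    case True
    have "output_prob n 3 A x (\<lambda>a. \<not> szbt_correct n x a) \<le>
        output_prob n 3 A x (\<lambda>a. a \<noteq> None \<and> \<not> szbt_correct n x a) + output_prob n 3 A x (\<lambda>a. a = None)"
      by (rule output_prob_le_add[OF fin]) auto
    then show ?thesis using A(3,4)[OF x] True by auto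
  next
    case False
    then have "szbt_correct n x None" by (simp add: szbt_correct_def)
    then have "(\<lambda>a. a \<noteq> None \<and> \<not> szbt_correct n x a) = (\<lambda>a. \<not> szbt_correct n x a)"
      by (intro ext) metis
    then show ?thesis using A(3)[OF x] by simp
  qed
  then show ?thesis using A(1,2) by blast
qed

lemma szbt_correct_restrict:
  assumes "1 \<le> n"
  shows "szbt_correct n (restrict f {..<n}) = szbt_correct n f"
proof -
  have "bounded_segment n (restrict f {..<n}) l r = bounded_segment n f l r" for l r
    using assms by (auto simp: bounded_segment_def)
  then show ?thesis by (auto simp: szbt_correct_def fun_eq_iff split: option.split)
qed

theorem theorem3:
  shows "\<exists>A :: nat \<Rightarrow> (nat, (nat \<times> nat) option) qalgorithm.
    (\<exists>C :: real. \<forall>n\<ge>1.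
       (query_algorithm n 3 (A n) \<and>
        real (query_count (qa_steps (A n))) \<le> C * sqrt (real n * ln (real n)) \<and>
        error_prob n 3 (query_inputs n 3) (\<lambda>f. szbt_correct n f) (A n) \<le> 1 / 10) \<and>
       (\<forall>(N :: nat) (q :: nat) (X :: (nat \<Rightarrow> nat) set) (f :: (nat \<Rightarrow> nat) \<Rightarrow> nat \<Rightarrow> nat)
          (V :: nat set) (v0 :: nat) (E :: (nat \<times> nat \<times> nat) qstep list).
          coherent_evaluation N q X n f V v0 E \<longrightarrow>
          query_algorithm N q (with_evaluation n (A n) V v0 E) \<and>
          real (query_count (qa_steps (with_evaluation n (A n) V v0 E)))
            \<le> C * (sqrt (real n * ln (real n)) * real (query_count E)) \<and>
          error_prob N q X (\<lambda>x. szbt_correct n (f x)) (with_evaluation n (A n) V v0 E) \<le> 1 / 10)) \<and>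
    (\<forall>(N :: nat \<Rightarrow> nat) (q :: nat \<Rightarrow> nat) (X :: nat \<Rightarrow> (nat \<Rightarrow> nat) set)
       (f :: nat \<Rightarrow> (nat \<Rightarrow> nat) \<Rightarrow> nat \<Rightarrow> nat)
       (V :: nat \<Rightarrow> nat set) (v0 :: nat \<Rightarrow> nat) (E :: nat \<Rightarrow> (nat \<times> nat \<times> nat) qstep list).
       (\<forall>n\<ge>1. coherent_evaluation (N n) (q n) (X n) n (f n) (V n) (v0 n) (E n)) \<longrightarrow>
       (\<lambda>n. real (query_count (E n))) \<in> O(\<lambda>n. 1) \<longrightarrow>
       (\<lambda>n. real (query_count (qa_steps (with_evaluation n (A n) (V n) (v0 n) (E n)))))
         \<in> O(\<lambda>n. sqrt (real n * ln (real n))))"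
proof -
  define C :: real where "C = 867600"
  \<comment> \<open>The algorithm is fixed for each \<open>n\<close> before any evaluation circuit
    is given, so one choice serves all circuits.\<close>
  have "\<forall>n. \<exists>A :: (nat, (nat \<times> nat) option) qalgorithm. 1 \<le> n \<longrightarrow> query_algorithm n 3 A \<and>
      real (query_count (qa_steps A)) \<le> C * sqrt (real n * ln (real n)) \<and>
      (\<forall>x\<in>query_inputs n 3. output_prob n 3 A x (\<lambda>a. \<not> szbt_correct n x a) \<le> 1 / 10)"
    using szbt_algorithm_exists unfolding C_def by blast
  then obtain A :: "nat \<Rightarrow> (nat, (nat \<times> nat) option) qalgorithm" where "\<forall>n. 1 \<le> n \<longrightarrow> query_algorithm n 3 (A n) \<and>
      real (query_count (qa_steps (A n))) \<le> C * sqrt (real n * ln (real n)) \<and>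
      (\<forall>x\<in>query_inputs n 3. output_prob n 3 (A n) x (\<lambda>a. \<not> szbt_correct n x a) \<le> 1 / 10)"
    by (elim choice[THEN exE])
  then have A: "query_algorithm n 3 (A n)"
      "real (query_count (qa_steps (A n))) \<le> C * sqrt (real n * ln (real n))"
      "\<And>x. x \<in> query_inputs n 3 \<Longrightarrow> output_prob n 3 (A n) x (\<lambda>a. \<not> szbt_correct n x a) \<le> 1 / 10"
    if "1 \<le> n" for n
    using that by blast+
  have finite_inputs: "finite (query_inputs N q)" for N q
    by (simp add: query_inputs_def finite_PiE)
  have direct: "error_prob n 3 (query_inputs n 3) (\<lambda>f. szbt_correct n f) (A n) \<le> 1 / 10" if n: "1 \<le> n" for n
  proof -
    \<comment> \<open>\<open>error_prob\<close> is a maximum, so a bound on it requires a nonempty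
      set of inputs.\<close>
    have "restrict (\<lambda>_. 0) {..<n} \<in> query_inputs n 3" by (simp add: query_inputs_def)
    then have "query_inputs n 3 \<noteq> {}" by blast
    then show ?thesis
      unfolding error_prob_def using A(3)[OF n] finite_inputs by (intro Max.boundedI) auto
  qed
  have evaluated: "query_algorithm N q (with_evaluation n (A n) V v0 E)"
      "real (query_count (qa_steps (with_evaluation n (A n) V v0 E)))
        \<le> C * (sqrt (real n * ln (real n)) * real (query_count E))"
      "error_prob N q X (\<lambda>x. szbt_correct n (f x)) (with_evaluation n (A n) V v0 E) \<le> 1 / 10"
    if n: "1 \<le> n" and eval: "coherent_evaluation N q X n f V v0 E"
    for n N q X f and V :: "nat set" and v0 E
  proof -
    interpret S: evaluated_algorithm N q X n f V v0 E "A n"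
      using eval A(1)[OF n] by unfold_locales
    show "query_algorithm N q (with_evaluation n (A n) V v0 E)" by (rule S.valid)
    show "real (query_count (qa_steps (with_evaluation n (A n) V v0 E)))
        \<le> C * (sqrt (real n * ln (real n)) * real (query_count E))"
      using mult_right_mono[OF A(2)[OF n], of "real (query_count E)"]
      by (simp add: query_count_with_evaluation mult.assoc)
    have "output_prob N q (with_evaluation n (A n) V v0 E) x (\<lambda>a. \<not> szbt_correct n (f x) a) \<le> 1 / 10"
      if x: "x \<in> X" for x
    proof -
      have "restrict (f x) {..<n} \<in> query_inputs n 3"
      proof -
        have "f x i < 3" if "i < n" for i
        proof -
          have "f x i \<in> {0, 1, 2}" using eval x that unfolding coherent_evaluation_def by blast
          then show ?thesis by auto
        qed
        then show ?thesis by (auto simp: query_inputs_def)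
      qed
      from A(3)[OF n this] show ?thesis
        by (simp add: S.output_prob_with_evaluation[OF x] szbt_correct_restrict[OF n])
    qed
    moreover have "finite X" "X \<noteq> {}"
      using eval finite_subset[OF _ finite_inputs] unfolding coherent_evaluation_def by blast+
    ultimately show "error_prob N q X (\<lambda>x. szbt_correct n (f x)) (with_evaluation n (A n) V v0 E) \<le> 1 / 10"
      unfolding error_prob_def by (intro Max.boundedI) auto
  qed
  have bigo: "(\<lambda>n. real (query_count (qa_steps (with_evaluation n (A n) (V n) (v0 n) (E n)))))
      \<in> O(\<lambda>n. sqrt (real n * ln (real n)))"
    if "(\<lambda>n. real (query_count (E n))) \<in> O(\<lambda>n. 1)"
    for V :: "nat \<Rightarrow> nat set" and v0 E
  proof -
    have "(\<lambda>n. real (query_count (qa_steps (A n)))) \<in> O(\<lambda>n. sqrt (real n * ln (real n)))"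
    proof (rule bigoI[of _ C])
      show "\<forall>\<^sub>F n in at_top. norm (real (query_count (qa_steps (A n)))) \<le> C * norm (sqrt (real n * ln (real n)))"
        using eventually_ge_at_top[of 1] by eventually_elim (use A(2) in auto)
    qed
    from landau_o.big_mult[OF this that] show ?thesis
      by (simp add: query_count_with_evaluation)
  qed
  show ?thesis
    by (intro exI[of _ A] exI[of _ C] conjI allI impI A(1,2) direct evaluated bigo)
qed

end
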